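(* The partition function can be represented as \begin{multline*}Z_n(x;y;\lambda)=\frac{\prod_{i,j=1}^n[y_j-x_i]}{[1]^{n(n-1)}\prod_{j=1}^n[\lambda+j-1]} \sum_{\sigma\in S_n}\prod_{1\leq i<j\leq n}\frac{[y_{\sigma(j)}-y_{\sigma(i)}+1][y_{\sigma(j)}-x_i-1]}{[y_{\sigma(j)}-y_{\sigma(i)}][y_{\sigma(j)}-x_i]}\\ \times\prod_{j=1}^n\frac{[y_{\sigma(j)}-x_j+\lambda+n-j]}{[y_{\sigma(j)}-x_j]}.\end{multline*}
   Context: Fix $\tau,\eta$ with $\operatorname{Im}(\tau)>0$, $\eta\notin\mathbb Z+\tau\mathbb Z$; let $p=e^{2\pi i\tau}$, $q=e^{2\pi i\eta}$, $q^x=e^{2\pi i\eta x}$, and $[x]=q^{-x/2}\prod_{j\ge0}(1-p^jq^x)(1-p^{j+1}q^{-x})$. A state is an $(n+1)\times(n+1)$ integer matrix with adjacent entries differing by $1$, first row and first column $0,1,\dots,n$, last row and last column $n,n-1,\dots,0$. Each block $\left(\begin{smallmatrix}a&b\\c&d\end{smallmatrix}\right)$ (adjacent $2\times2$ submatrix) at position $(i,j)$, $1\le i,j\le n$, has weight $R^{b-a,d-b}_{d-c,c-a}(\lambda+a,x_i-y_j)$, with $R^{++}_{++}=R^{--}_{--}=[u+1]/[1]$, $R^{+-}_{+-}(\lambda,u)=[u][\lambda+1]/([1][\lambda])$, $R^{-+}_{-+}(\lambda,u)=[u][\lambda-1]/([1][\lambda])$, $R^{-+}_{+-}(\lambda,u)=[\lambda+u]/[\lambda]$,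 $R^{+-}_{-+}(\lambda,u)=[\lambda-u]/[\lambda]$. $Z_n(x;y;\lambda)$ is the sum over states of the products of block weights (8VSOS model, domain wall boundary conditions), for generic complex $\lambda,x_i,y_j$. *)

theory Defs
  imports
    "HOL-Analysis.Infinite_Products"
    "HOL-Analysis.Complex_Transcendental"
    "HOL-Combinatorics.Permutations"
begin

definition nome :: "complex \<Rightarrow> complex" where
  "nome \<tau> = exp (2 * of_real pi * \<i> * \<tau>)"

(* q powers are exp (2 pi i eta x) for all complex x, so no branch of q powr x is involved. *)
definition qpow :: "complex \<Rightarrow> complex \<Rightarrow> complex" where
  "qpow \<eta> x = exp (2 * of_real pi * \<i> * \<eta> * x)"

(* The infinite product converges for Im \<tau> > 0; prodinf also returns the right value when
   a factor vanishes. *)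
definition br :: "complex \<Rightarrow> complex \<Rightarrow> complex \<Rightarrow> complex" where
  "br \<tau> \<eta> x = qpow \<eta> (- x / 2) *
     (\<Prod>j. (1 - nome \<tau> ^ j * qpow \<eta> x) * (1 - nome \<tau> ^ (j + 1) * qpow \<eta> (- x)))"

(* Rweight \<tau> \<eta> k l m n lam u is the weight with upper indices k, l and lower indices m, n, the signs
   + and - being 1 and -1. For an adjacent block of a state k + l = m + n, so that only the
   six listed cases occur. *)
definition Rweight ::
  "complex \<Rightarrow> complex \<Rightarrow> int \<Rightarrow> int \<Rightarrow> int \<Rightarrow> int \<Rightarrow> complex \<Rightarrow> complex \<Rightarrow> complex" where
  "Rweight \<tau> \<eta> k l m n lam u =
    (if (k, l, m, n) = (1, 1, 1, 1) \<or> (k, l, m, n) = (-1, -1, -1, -1)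
       then br \<tau> \<eta> (u + 1) / br \<tau> \<eta> 1
     else if (k, l, m, n) = (1, -1, 1, -1)
       then br \<tau> \<eta> u * br \<tau> \<eta> (lam + 1) / (br \<tau> \<eta> 1 * br \<tau> \<eta> lam)
     else if (k, l, m, n) = (-1, 1, -1, 1)
       then br \<tau> \<eta> u * br \<tau> \<eta> (lam - 1) / (br \<tau> \<eta> 1 * br \<tau> \<eta> lam)
     else if (k, l, m, n) = (-1, 1, 1, -1)
       then br \<tau> \<eta> (lam + u) / br \<tau> \<eta> lam
     else if (k, l, m, n) = (1, -1, -1, 1)
       then br \<tau> \<eta> (lam - u) / br \<tau> \<eta> lam
     else 0)"

(* Rows and columns are indexed by 0..n. A matrix is a function that is 0 outside the index
   range, so that each matrix is represented once and the set of states is finite. *)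
definition states :: "nat \<Rightarrow> (nat \<Rightarrow> nat \<Rightarrow> int) set" where
  "states n = {h.
     (\<forall>i j. i > n \<or> j > n \<longrightarrow> h i j = 0) \<and>
     (\<forall>i<n. \<forall>j\<le>n. \<bar>h (i + 1) j - h i j\<bar> = 1) \<and>
     (\<forall>i\<le>n. \<forall>j<n. \<bar>h i (j + 1) - h i j\<bar> = 1) \<and>
     (\<forall>k\<le>n. h 0 k = int k \<and> h k 0 = int k \<and>
             h n k = int n - int k \<and> h k n = int n - int k)}"

(* The block at position (i, j), 1 \<le> i, j \<le> n, has its lower right entry at index (i, j). *)
definition block_weight ::
  "complex \<Rightarrow> complex \<Rightarrow> (nat \<Rightarrow> complex) \<Rightarrow> (nat \<Rightarrow> complex) \<Rightarrow> complex \<Rightarrow>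
   (nat \<Rightarrow> nat \<Rightarrow> int) \<Rightarrow> nat \<Rightarrow> nat \<Rightarrow> complex" where
  "block_weight \<tau> \<eta> x y lam h i j =
    (let a = h (i - 1) (j - 1); b = h (i - 1) j; c = h i (j - 1); d = h i j
     in Rweight \<tau> \<eta> (b - a) (d - b) (d - c) (c - a) (lam + of_int a) (x i - y j))"

definition Zpart ::
  "complex \<Rightarrow> complex \<Rightarrow> nat \<Rightarrow> (nat \<Rightarrow> complex) \<Rightarrow> (nat \<Rightarrow> complex) \<Rightarrow> complex \<Rightarrow> complex" where
  "Zpart \<tau> \<eta> n x y lam =
    (\<Sum>h\<in>states n. \<Prod>i=1..n. \<Prod>j=1..n. block_weight \<tau> \<eta> x y lam h i j)"

end

theory Submission
  imports Defs "HOL-Complex_Analysis.Complex_Analysis"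
begin

text \<open>
  The bracket \<open>[x]\<close> is a theta function, and Liouville's theorem gives Weierstrass' three-term
  identity for it; everything else is algebra. The three-term identity implies the dynamical
  Yang--Baxter equation, by which \<open>Z\<^sub>n\<close> is symmetric in the \<open>y\<^sub>j\<close>. As a function of \<open>x\<^sub>n\<close>, the
  partition function is a combination of products of \<open>n\<close> shifted brackets with a fixed sum of
  shifts, so it is determined by Lagrange interpolation from its values at \<open>x\<^sub>n = y\<^sub>k\<close>. By symmetry
  one may move \<open>y\<^sub>k\<close> to the first column; there \<open>x\<^sub>n = y\<^sub>k\<close> freezes the last row and the first column,
  which leaves \<open>Z\<^bsub>n-1\<^esub>\<close> with \<open>\<lambda> + 1\<close> in place of \<open>\<lambda>\<close>. The resulting recursion is the
  decomposition of the sum over \<open>\<sigma>\<close> by the value \<open>\<sigma> n = k\<close>.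
\<close>

section \<open>The theta function\<close>

text \<open>Brackets occur in denominators at every stage, and more of them than the theorem
  supposes to be nonzero: the Yang--Baxter equation is proved when all
  \<open>b (lam + of_int k)\<close> are nonzero, the exchange of two columns cancels a factor
  \<open>b (y j - y i + 1)\<close>, and the induction behind the interpolation formula divides by
  the bracket of a sum of shifts. Each identity is therefore proved for generic parameters and
  carried over to the exceptional ones along a complex line, on which the zeros of the brackets are
  countable, whereas every ball is uncountable. Continuity at a single point then suffices
  (\<open>isCont_eq_off_countable\<close>), which matters because the functions concerned have poles
  elsewhere. No dimension of a space of theta functions is computed: the interpolation formula is
  itself a consequence of the three-term identity, and it is applied to the last row of each state
  separately.\<close>

definition qprod :: "complex \<Rightarrow> complex \<Rightarrow> complex" where
  "qprod p X = (\<Prod>j. 1 - p ^ j * X)"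

lemma convergent_qprod:
  fixes p X :: complex
  assumes "norm p < 1"
  shows "convergent_prod (\<lambda>j. 1 - p ^ j * X)"
proof (rule abs_convergent_prod_imp_convergent_prod, rule summable_imp_abs_convergent_prod)
  show "summable (\<lambda>i. norm (1 - p ^ i * X - 1))"
    using assms by (simp add: norm_mult norm_power summable_mult2 summable_geometric)
qed

lemma qprod_shift:
  assumes "norm p < 1"
  shows "qprod p X = (1 - X) * qprod p (p * X)"
proof -
  have "(\<lambda>j. 1 - p ^ j * X) has_prod ((\<Prod>k<1. 1 - p ^ k * X) * (\<Prod>k. 1 - p ^ (k + 1) * X))"
    by (rule has_prod_ignore_initial_segment'[OF convergent_qprod[OF assms]])
  thus ?thesis
    by (simp add: qprod_def has_prod_iff mult_ac)
qed

lemma qprod_eq_0_iff: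
  assumes "norm p < 1"
  shows "qprod p X = 0 \<longleftrightarrow> (\<exists>j. p ^ j * X = 1)"
proof -
  have "(\<lambda>j. 1 - p ^ j * X) has_prod qprod p X"
    unfolding qprod_def by (rule convergent_prod_has_prod[OF convergent_qprod[OF assms]])
  from has_prod_eq_0_iff[OF this] show ?thesis
    by (auto simp: image_iff algebra_simps)
qed

lemma holomorphic_qprod:
  assumes "norm p < 1"
  shows "qprod p holomorphic_on UNIV"
proof (rule holomorphic_uniform_sequence)
  show "(\<lambda>X. \<Prod>j<n. 1 - p ^ j * X) holomorphic_on UNIV" for n
    by (intro holomorphic_intros)
next
  fix X :: complex
  let ?K = "cball X 1"
  have "uniformly_convergent_on ?K (\<lambda>N z. \<Prod>n<N. 1 - p ^ n * z)"
  proof (rule uniformly_convergent_on_prod')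
    show "uniformly_convergent_on ?K (\<lambda>N z. \<Sum>n<N. norm (1 - p ^ n * z - 1))"
    proof (rule Weierstrass_m_test')
      show "summable (\<lambda>n. norm p ^ n * (norm X + 1))"
        using assms by (intro summable_mult2 summable_geometric) auto
      show "norm (norm (1 - p ^ n * z - 1)) \<le> norm p ^ n * (norm X + 1)" if "z \<in> ?K" for n z
      proof -
        have "norm z \<le> norm X + 1"
          using that norm_triangle_sub[of z X] by (auto simp: dist_norm norm_minus_commute)
        thus ?thesis by (simp add: norm_mult norm_power mult_left_mono)
      qed
    qed
  qed (auto intro!: continuous_intros)
  hence "uniform_limit ?K (\<lambda>N z. \<Prod>n<N. 1 - p ^ n * z) (\<lambda>z. lim (\<lambda>N. \<Prod>n<N. 1 - p ^ n * z)) sequentially"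
    by (simp add: uniformly_convergent_uniform_limit_iff)
  moreover have "lim (\<lambda>N. \<Prod>n<N. 1 - p ^ n * z) = qprod p z" for z
    unfolding qprod_def
    using convergent_prod_has_prod[OF convergent_qprod[OF assms]]
    by (intro limI has_prod_imp_tendsto')
  ultimately have "uniform_limit ?K (\<lambda>N z. \<Prod>n<N. 1 - p ^ n * z) (qprod p) sequentially"
    by simp
  thus "\<exists>d>0. cball X d \<subseteq> UNIV \<and> uniform_limit (cball X d) (\<lambda>N z. \<Prod>n<N. 1 - p ^ n * z) (qprod p) sequentially"
    by (intro exI[of _ 1]) auto
qed auto

lemma norm_nome_less_1: "Im \<tau> > 0 \<Longrightarrow> norm (nome \<tau>) < 1"
  by (simp add: nome_def)

text \<open>Up to a constant factor depending on \<tau> this is Jacobi's odd theta function. Since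
  \<eta> only rescales the argument (\<open>br_eq_theta\<close>), the analysis takes place in the
  variable u = \<eta> x, where the quasi-periods are 1 and \<tau>.\<close>

definition theta :: "complex \<Rightarrow> complex \<Rightarrow> complex" where
  "theta \<tau> u = br \<tau> 1 u"

lemma br_eq_theta: "br \<tau> \<eta> x = theta \<tau> (\<eta> * x)"
  by (simp add: theta_def br_def qpow_def mult_ac)

text \<open>The even factor that remains when -2i sin(pi u), which carries the zero at 0, is split
  off from \<open>theta\<close>. Oddness of \<open>theta\<close> and the simplicity of its zero at 0
  are read off from this factorisation.\<close>

definition theta_cofactor :: "complex \<Rightarrow> complex \<Rightarrow> complex" where
  "theta_cofactor \<tau> u = qprod (nome \<tau>) (nome \<tau> * exp (2 * of_real pi * \<i> * u)) *
     qprod (nome \<tau>) (nome \<tau> * exp (- (2 * of_real pi * \<i> * u)))"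

lemma theta_eq_qprod:
  assumes "Im \<tau> > 0"
  shows "theta \<tau> u = exp (- (of_real pi * \<i> * u)) *
     (qprod (nome \<tau>) (exp (2 * of_real pi * \<i> * u)) *
      qprod (nome \<tau>) (nome \<tau> * exp (- (2 * of_real pi * \<i> * u))))"
proof -
  note c = convergent_qprod[OF norm_nome_less_1[OF assms]]
  show ?thesis
    unfolding theta_def br_def qpow_def qprod_def
    by (subst prodinf_mult[OF c c]) (simp add: mult_ac)
qed

lemma theta_eq_theta_cofactor:
  assumes "Im \<tau> > 0"
  shows "theta \<tau> u = (exp (- (of_real pi * \<i> * u)) - exp (of_real pi * \<i> * u)) * theta_cofactor \<tau> u"
proof -
  have *: "exp (- (of_real pi * \<i> * u)) * (1 - exp (2 * of_real pi * \<i> * u)) =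
     exp (- (of_real pi * \<i> * u)) - exp (of_real pi * \<i> * u)"
    by (simp add: algebra_simps flip: exp_add)
  show ?thesis
    unfolding theta_eq_qprod[OF assms] theta_cofactor_def
    by (subst qprod_shift[OF norm_nome_less_1[OF assms]]) (simp add: * mult.assoc[symmetric])
qed

lemma theta_minus [simp]: "Im \<tau> > 0 \<Longrightarrow> theta \<tau> (- u) = - theta \<tau> u"
  by (simp add: theta_eq_theta_cofactor theta_cofactor_def algebra_simps)

lemma theta_plus_1: "Im \<tau> > 0 \<Longrightarrow> theta \<tau> (u + 1) = - theta \<tau> u"
  by (simp add: theta_eq_qprod ring_distribs exp_add exp_minus exp_diff exp_minus_inverse)

text \<open>Passing from X to p X removes the factor 1 - X from the first product and adds the
  factor 1 - 1/X to the second; since 1 - 1/X = -(1 - X)/X, only -1/X and an exponential are left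
  over.\<close>

lemma theta_plus_tau:
  assumes "Im \<tau> > 0"
  shows "theta \<tau> (u + \<tau>) = - exp (- (of_real pi * \<i> * (2 * u + \<tau>))) * theta \<tau> u"
proof -
  define X where "X = exp (2 * of_real pi * \<i> * u)"
  define p where "p = nome \<tau>"
  have X: "X \<noteq> 0" and p: "p \<noteq> 0" "norm p < 1"
    using assms by (simp_all add: X_def p_def nome_def)
  have e: "exp (2 * of_real pi * \<i> * (u + \<tau>)) = p * X" "exp (- (2 * of_real pi * \<i> * (u + \<tau>))) = inverse (p * X)"
    "exp (- (2 * of_real pi * \<i> * u)) = inverse X"
    by (simp_all add: X_def p_def nome_def ring_distribs exp_add exp_minus exp_diff mult_ac divide_inverse)
  have "theta \<tau> (u + \<tau>) = exp (- (of_real pi * \<i> * (u + \<tau>))) * (qprod p (p * X) * qprod p (inverse X))"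
    using p X by (simp add: theta_eq_qprod[OF assms] e flip: p_def) (simp add: field_simps)
  also have "qprod p (inverse X) = (1 - inverse X) * qprod p (p * inverse X)"
    by (rule qprod_shift[OF p(2)])
  also have "qprod p (p * X) * ((1 - inverse X) * qprod p (p * inverse X)) =
      - inverse X * (((1 - X) * qprod p (p * X)) * qprod p (p * inverse X))"
    using X by (simp add: field_simps)
  also have "(1 - X) * qprod p (p * X) = qprod p X"
    by (rule qprod_shift[OF p(2), symmetric])
  also have "exp (- (of_real pi * \<i> * (u + \<tau>))) * (- inverse X * (qprod p X * qprod p (p * inverse X))) =
     - exp (- (of_real pi * \<i> * (2 * u + \<tau>))) * theta \<tau> u"
  proof -
    have "exp (- (of_real pi * \<i> * (u + \<tau>))) * inverse X =
       exp (- (of_real pi * \<i> * (2 * u + \<tau>))) * exp (- (of_real pi * \<i> * u))"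
      unfolding e(3)[symmetric] exp_add[symmetric] by (simp add: algebra_simps)
    thus ?thesis
      by (simp add: theta_eq_qprod[OF assms] e mult.assoc[symmetric] flip: p_def X_def)
  qed
  finally show ?thesis .
qed

lemma holomorphic_theta_cofactor: "Im \<tau> > 0 \<Longrightarrow> theta_cofactor \<tau> holomorphic_on A"
proof -
  assume "Im \<tau> > 0"
  from holomorphic_qprod[OF norm_nome_less_1[OF this]]
  have q: "(\<lambda>z. qprod (nome \<tau>) (g z)) holomorphic_on A" if "g holomorphic_on A" for g A
    using holomorphic_on_compose_gen[OF that, of "qprod (nome \<tau>)" UNIV] by (auto simp: o_def)
  show ?thesis
    unfolding theta_cofactor_def[abs_def] by (intro holomorphic_intros q)
qed

lemma holomorphic_theta: "Im \<tau> > 0 \<Longrightarrow> theta \<tau> holomorphic_on A"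
  by (subst holomorphic_cong[OF refl theta_eq_theta_cofactor]) (intro holomorphic_intros holomorphic_theta_cofactor | assumption)+

lemma holomorphic_theta_compose [holomorphic_intros]:
  "Im \<tau> > 0 \<Longrightarrow> f holomorphic_on A \<Longrightarrow> (\<lambda>z. theta \<tau> (f z)) holomorphic_on A"
  using holomorphic_on_compose_gen[of f A "theta \<tau>" UNIV] holomorphic_theta by (auto simp: o_def)

lemma isCont_theta_compose [continuous_intros]:
  assumes "Im \<tau> > 0" "isCont f z" shows "isCont (\<lambda>z. theta \<tau> (f z)) z"
proof -
  have "continuous_on UNIV (theta \<tau>)"
    using holomorphic_theta[OF assms(1)] by (rule holomorphic_on_imp_continuous_on)
  hence "isCont (theta \<tau>) (f z)" by (simp add: continuous_on_eq_continuous_at)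
  with assms(2) show ?thesis by (rule isCont_o2)
qed

lemma theta_0 [simp]: "Im \<tau> > 0 \<Longrightarrow> theta \<tau> 0 = 0"
  by (simp add: theta_eq_theta_cofactor)

section \<open>Zeros of the theta function and division by it\<close>

lemma theta_eq_0_iff:
  assumes "Im \<tau> > 0"
  shows "theta \<tau> u = 0 \<longleftrightarrow> (\<exists>k l. u = of_int k + \<tau> * of_int l)"
proof
  assume "\<exists>k l. u = of_int k + \<tau> * of_int l"
  then obtain k l where u: "u = of_int k + \<tau> * of_int l" by blast
  have a: "theta \<tau> (v + of_int k) = 0 \<longleftrightarrow> theta \<tau> v = 0" for v and k :: int
  proof (induction k rule: int_induct[where k = 0])
    case (step1 i)
    thus ?case using theta_plus_1[OF assms, of "v + of_int i"] by (simp add: add_ac)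
  next
    case (step2 i)
    thus ?case using theta_plus_1[OF assms, of "v + of_int (i - 1)"] by (simp add: add_ac)
  qed auto
  have b: "theta \<tau> (v + \<tau> * of_int l) = 0 \<longleftrightarrow> theta \<tau> v = 0" for v and l :: int
  proof (induction l rule: int_induct[where k = 0])
    case (step1 i)
    thus ?case using theta_plus_tau[OF assms, of "v + \<tau> * of_int i"] by (simp add: algebra_simps)
  next
    case (step2 i)
    thus ?case using theta_plus_tau[OF assms, of "v + \<tau> * of_int (i - 1)"] by (simp add: algebra_simps)
  qed auto
  show "theta \<tau> u = 0"
    using a[of 0 k] b[of "of_int k" l] assms by (simp add: u)
next
  assume *: "theta \<tau> u = 0"
  have m: "norm (nome \<tau>) < 1" by (rule norm_nome_less_1[OF assms])
  \<comment> \<open>The sign \<open>s\<close> treats both products at once: a vanishing factor of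
    the first gives s = 1 and m = j, one of the second gives s = -1 and m = j + 1. The exponent is
    then an integral multiple of 2 pi i.\<close>
  have ex: "\<exists>k l. u = of_int k + \<tau> * of_int l"
    if "exp (2 * of_real pi * \<i> * (\<tau> * of_int m + s * u)) = 1" "s = 1 \<or> s = -1" for m :: int and s
  proof -
    from that(1) obtain n :: int where
      "2 * of_real pi * \<i> * (\<tau> * of_int m + s * u) = of_int (2 * n) * of_real pi * \<i>"
      using exp_eq[of "2 * of_real pi * \<i> * (\<tau> * of_int m + s * u)" 0] by auto
    hence "2 * of_real pi * \<i> * (\<tau> * of_int m + s * u) = 2 * of_real pi * \<i> * of_int n"
      by (simp add: mult_ac)
    hence n: "\<tau> * of_int m + s * u = of_int n" by (simp del: of_int_mult)
    show ?thesis
    proof (cases "s = 1")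
      case True
      with n have "u = of_int n + \<tau> * of_int (- m)" by (simp add: algebra_simps)
      thus ?thesis by blast
    next
      case False
      with that n have "u = of_int (- n) + \<tau> * of_int m" by (simp add: algebra_simps)
      thus ?thesis by blast
    qed
  qed
  have np: "nome \<tau> ^ j = exp (2 * of_real pi * \<i> * (\<tau> * of_int (int j)))" for j
    by (simp add: nome_def mult_ac flip: exp_of_nat_mult)
  from * consider j where "nome \<tau> ^ j * exp (2 * of_real pi * \<i> * u) = 1"
    | j where "nome \<tau> ^ Suc j * exp (- (2 * of_real pi * \<i> * u)) = 1"
    by (auto simp: theta_eq_qprod[OF assms] qprod_eq_0_iff[OF m] mult_ac)
  thus "\<exists>k l. u = of_int k + \<tau> * of_int l"
  proof cases
    case 1
    thus ?thesis by (intro ex[of "int j" 1]) (simp_all add: np ring_distribs exp_add)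
  next
    case 2
    thus ?thesis by (intro ex[of "int (Suc j)" "-1"]) (simp_all only: np ring_distribs exp_add, simp_all add: exp_add)
  qed
qed

text \<open>All zeros are simple. At 0 this holds because \<open>theta_cofactor\<close> is nonzero
  there. Differentiating theta(u + c) = g(u) theta(u) at a zero v leaves only g(v) theta'(v), so
  simplicity passes in both directions along the quasi-periods 1 and \<tau>, whose multipliers never
  vanish.\<close>

lemma deriv_theta_nonzero:
  assumes "Im \<tau> > 0" "theta \<tau> z = 0"
  obtains D where "(theta \<tau> has_field_derivative D) (at z)" "D \<noteq> 0"
proof -
  define s where "s = (\<lambda>u. exp (- (of_real pi * \<i> * u)) - exp (of_real pi * \<i> * u))"
  have th: "theta \<tau> = (\<lambda>u. s u * theta_cofactor \<tau> u)"
    using theta_eq_theta_cofactor[OF assms(1)] by (auto simp: s_def)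
  have D0: "\<exists>D. (theta \<tau> has_field_derivative D) (at 0) \<and> D \<noteq> 0"
  proof -
    obtain D where D: "(theta_cofactor \<tau> has_field_derivative D) (at 0)"
      using holomorphic_theta_cofactor[OF assms(1), of UNIV]
      by (auto simp: holomorphic_on_def field_differentiable_def)
    have s': "(s has_field_derivative - (2 * of_real pi * \<i>)) (at 0)"
      unfolding s_def by (auto intro!: derivative_eq_intros)
    have d: "(theta \<tau> has_field_derivative s 0 * D + - (2 * of_real pi * \<i>) * theta_cofactor \<tau> 0) (at 0)"
      unfolding th by (rule DERIV_mult'[OF s' D])
    have m: "norm (nome \<tau>) < 1" by (rule norm_nome_less_1[OF assms(1)])
    have "nome \<tau> ^ Suc j \<noteq> 1" for j
    proof
      assume "nome \<tau> ^ Suc j = 1"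
      hence "norm (nome \<tau>) ^ Suc j = 1" by (metis norm_one norm_power)
      with m show False
        using power_less_one_iff[of "norm (nome \<tau>)" "Suc j"] by simp
    qed
    hence "qprod (nome \<tau>) (nome \<tau>) \<noteq> 0"
      by (subst qprod_eq_0_iff[OF m]) (simp add: mult_ac)
    hence "theta_cofactor \<tau> 0 \<noteq> 0" by (simp add: theta_cofactor_def)
    with d show ?thesis by (intro exI[of _ "- (2 * of_real pi * \<i>) * theta_cofactor \<tau> 0"]) (simp add: s_def)
  qed
  have shift: "\<exists>D. (theta \<tau> has_field_derivative D) (at (v + c)) \<and> D \<noteq> 0"
    if D: "\<exists>D. (theta \<tau> has_field_derivative D) (at v) \<and> D \<noteq> 0" and v: "theta \<tau> v = 0"
      and g: "\<And>u. theta \<tau> (u + c) = g u * theta \<tau> u" "g holomorphic_on UNIV" "g v \<noteq> 0" for v c g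
  proof -
    from D obtain D where D: "(theta \<tau> has_field_derivative D) (at v)" "D \<noteq> 0" by blast
    obtain G where G: "(g has_field_derivative G) (at v)"
      using g(2) by (auto simp: holomorphic_on_def field_differentiable_def)
    have "((\<lambda>u. theta \<tau> (u + c)) has_field_derivative g v * D + G * theta \<tau> v) (at v)"
      unfolding g(1) by (rule DERIV_mult'[OF G D(1)])
    hence "(theta \<tau> has_field_derivative g v * D) (at (v + c))"
      by (simp add: v DERIV_shift)
    with D(2) g(3) show ?thesis by (intro exI[of _ "g v * D"]) simp
  qed
  have unshift: "\<exists>D. (theta \<tau> has_field_derivative D) (at v) \<and> D \<noteq> 0"
    if D: "\<exists>D. (theta \<tau> has_field_derivative D) (at (v + c)) \<and> D \<noteq> 0" and v: "theta \<tau> (v + c) = 0"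
      and g: "\<And>u. theta \<tau> (u + c) = g u * theta \<tau> u" "g holomorphic_on UNIV" "\<And>u. g u \<noteq> 0" for v c g
  proof -
    have "\<exists>D. (theta \<tau> has_field_derivative D) (at (v + c + - c)) \<and> D \<noteq> 0"
    proof (rule shift[OF D v, where g = "\<lambda>u. inverse (g (u - c))"])
      show "theta \<tau> (u + - c) = inverse (g (u - c)) * theta \<tau> u" for u
        using g(1)[of "u - c"] g(3) by (simp add: field_simps)
      have "(\<lambda>u. g (u - c)) holomorphic_on UNIV"
        using holomorphic_on_compose_gen[OF _ g(2), of "\<lambda>u. u - c" UNIV]
        by (simp add: o_def holomorphic_on_diff)
      thus "(\<lambda>u. inverse (g (u - c))) holomorphic_on UNIV"
        using g(3) by (intro holomorphic_intros) auto
    qed (use g in auto)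
    thus ?thesis by simp
  qed
  have zero: "theta \<tau> (of_int k + \<tau> * of_int l) = 0" for k l
    using theta_eq_0_iff[OF assms(1)] by blast
  define g1 where "g1 = (\<lambda>u::complex. -1 :: complex)"
  define g2 where "g2 = (\<lambda>u. - exp (- (of_real pi * \<i> * (2 * u + \<tau>))))"
  have g1: "theta \<tau> (u + 1) = g1 u * theta \<tau> u" "g1 holomorphic_on UNIV" "g1 u \<noteq> 0" for u
    by (simp_all add: g1_def theta_plus_1[OF assms(1)])
  have g2: "theta \<tau> (u + \<tau>) = g2 u * theta \<tau> u" "g2 holomorphic_on UNIV" "g2 u \<noteq> 0" for u
    unfolding g2_def by (auto simp: theta_plus_tau[OF assms(1)] intro!: holomorphic_intros)
  have A: "\<exists>D. (theta \<tau> has_field_derivative D) (at (of_int k)) \<and> D \<noteq> 0" for k :: int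
  proof (induction k rule: int_induct[where k = 0])
    case (step1 i)
    show ?case using shift[OF step1(2) _ g1] zero[of i 0] by simp
  next
    case (step2 i)
    show ?case using unshift[of "of_int (i - 1)" 1 g1, OF _ _ g1] step2(2) zero[of i 0] by simp
  qed (use D0 in auto)
  have B: "\<exists>D. (theta \<tau> has_field_derivative D) (at (of_int k + \<tau> * of_int l)) \<and> D \<noteq> 0" for k l :: int
  proof (induction l rule: int_induct[where k = 0])
    case (step1 i)
    show ?case using shift[OF step1(2) zero g2] by (simp add: algebra_simps)
  next
    case (step2 i)
    show ?case using unshift[of "of_int k + \<tau> * of_int (i - 1)" \<tau> g2, OF _ _ g2] step2(2) zero[of k i]
      by (simp add: algebra_simps)
  qed (use A in auto)
  from assms(2) B that show thesis
    unfolding theta_eq_0_iff[OF assms(1)] by blast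
qed

text \<open>At a zero of \<open>theta\<close> the quotient is filled in by l'Hopital's rule, which
  applies because the zeros are simple. The result is continuous, and holomorphic off isolated
  points, hence entire.\<close>

lemma holomorphic_divide_theta:
  assumes "Im \<tau> > 0" "f holomorphic_on UNIV" "\<And>z. theta \<tau> z = 0 \<Longrightarrow> f z = 0"
  shows "\<exists>h. h holomorphic_on UNIV \<and> (\<forall>z. f z = theta \<tau> z * h z)"
proof -
  define h where "h = (\<lambda>z. if theta \<tau> z = 0 then deriv f z / deriv (theta \<tau>) z else f z / theta \<tau> z)"
  have hol: "theta \<tau> holomorphic_on UNIV" by (rule holomorphic_theta[OF assms(1)])
  have ev: "eventually (\<lambda>w. theta \<tau> w \<noteq> 0) (at z)" for z
  proof (cases "theta \<tau> z = 0")
    case False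
    have "isCont (theta \<tau>) z" by (intro isCont_theta_compose assms continuous_ident)
    with False show ?thesis
      unfolding isCont_def by (simp add: tendsto_imp_eventually_ne)
  next
    case True
    then obtain D where "(theta \<tau> has_field_derivative D) (at z)" "D \<noteq> 0"
      using deriv_theta_nonzero[OF assms(1)] by blast
    hence "\<forall>\<^sub>F w in at z. (theta \<tau> w - theta \<tau> z) / (w - z) \<noteq> 0"
      unfolding has_field_derivative_iff by (rule tendsto_imp_eventually_ne)
    thus ?thesis by eventually_elim (use True in auto)
  qed
  have lim: "(h \<longlongrightarrow> h z) (at z)" for z
  proof (cases "theta \<tau> z = 0")
    case True
    obtain D where D: "(theta \<tau> has_field_derivative D) (at z)" "D \<noteq> 0"
      using deriv_theta_nonzero[OF assms(1) True] by blast
    have "f field_differentiable at z" using assms(2) by (simp add: holomorphic_on_def)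
    hence F: "(f has_field_derivative deriv f z) (at z)" by (simp add: DERIV_deriv_iff_field_differentiable)
    have "((\<lambda>w. f w / theta \<tau> w) \<longlongrightarrow> h z) (at z)"
      using True D
      by (intro lhopital_complex_simple[OF F D(1)] assms(3)) (auto simp: h_def DERIV_imp_deriv)
    moreover have "\<forall>\<^sub>F w in at z. f w / theta \<tau> w = h w"
      using ev[of z] by eventually_elim (auto simp: h_def)
    ultimately show ?thesis by (rule Lim_transform_eventually)
  next
    case False
    have "isCont f z" using assms(2) holomorphic_on_imp_continuous_on continuous_on_eq_continuous_at by blast
    hence "((\<lambda>w. f w / theta \<tau> w) \<longlongrightarrow> h z) (at z)"
      using False isCont_theta_compose[OF assms(1) continuous_ident, of z]
      by (auto simp: h_def intro!: tendsto_divide isContD)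
    moreover have "\<forall>\<^sub>F w in at z. f w / theta \<tau> w = h w"
      using ev[of z] by eventually_elim (auto simp: h_def)
    ultimately show ?thesis by (rule Lim_transform_eventually)
  qed
  have "h holomorphic_on UNIV"
    unfolding holomorphic_on_def
  proof safe
    fix z :: complex
    from ev[of z] obtain r where r: "r > 0" "\<And>w. w \<noteq> z \<Longrightarrow> dist w z < r \<Longrightarrow> theta \<tau> w \<noteq> 0"
      by (auto simp: eventually_at)
    have "h holomorphic_on ball z r"
    proof (rule no_isolated_singularity)
      show "continuous_on (ball z r) h"
        using lim by (intro continuous_at_imp_continuous_on) (auto simp: isCont_def)
      have "(\<lambda>w. f w / theta \<tau> w) holomorphic_on ball z r - {z}"
        using r(2) by (intro holomorphic_intros holomorphic_on_subset[OF assms(2)] holomorphic_on_subset[OF hol])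
          (auto simp: dist_commute)
      thus "h holomorphic_on ball z r - {z}"
        by (rule holomorphic_transform) (use r(2) in \<open>auto simp: h_def dist_commute\<close>)
    qed auto
    with r(1) show "h field_differentiable at z within UNIV"
      by (auto intro: holomorphic_on_imp_differentiable_at)
  qed
  moreover have "f z = theta \<tau> z * h z" for z
    using assms(3)[of z] by (auto simp: h_def)
  ultimately show ?thesis by blast
qed

section \<open>Countable zero sets and the passage to exceptional parameters\<close>

lemma countable_theta_zeros:
  assumes "Im \<tau> > 0" "c \<noteq> 0"
  shows "countable {t. theta \<tau> (a + c * t) = 0}"
proof -
  have "{t. theta \<tau> (a + c * t) = 0} \<subseteq> range (\<lambda>(k::int, l::int). (of_int k + \<tau> * of_int l - a) / c)"
  proof
    fix t assume "t \<in> {t. theta \<tau> (a + c * t) = 0}"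
    then obtain k l where "a + c * t = of_int k + \<tau> * of_int l"
      unfolding mem_Collect_eq theta_eq_0_iff[OF assms(1)] by blast
    hence "t = (of_int k + \<tau> * of_int l - a) / c" using assms(2) by (simp add: field_simps)
    thus "t \<in> range (\<lambda>(k::int, l::int). (of_int k + \<tau> * of_int l - a) / c)"
      by (intro image_eqI[of _ _ "(k, l)"]) auto
  qed
  thus ?thesis by (rule countable_subset) auto
qed

text \<open>If the values at \<open>a\<close> differed, f and g would differ on a whole punctured
  ball around \<open>a\<close>, which is uncountable and so not contained in \<open>B\<close>.
  Unlike the identity theorem, this asks for continuity at \<open>a\<close> only.\<close>

lemma isCont_eq_off_countable:
  fixes f g :: "complex \<Rightarrow> complex"
  assumes "isCont f a" "isCont g a" "countable B" "\<And>t. t \<notin> B \<Longrightarrow> f t = g t"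
  shows "f a = g a"
proof (rule ccontr)
  assume "f a \<noteq> g a"
  moreover have "((\<lambda>t. f t - g t) \<longlongrightarrow> f a - g a) (at a)"
    using assms(1,2) by (intro tendsto_intros isContD)
  ultimately have "\<forall>\<^sub>F t in at a. f t - g t \<noteq> 0"
    by (intro tendsto_imp_eventually_ne) auto
  then obtain r where r: "r > 0" "\<And>t. t \<noteq> a \<Longrightarrow> dist t a < r \<Longrightarrow> f t \<noteq> g t"
    by (auto simp: eventually_at)
  have "ball a r \<subseteq> insert a B"
    using r assms(4) by (metis dist_commute insertCI mem_ball subsetI)
  moreover have "countable (insert a B)" using assms(3) by simp
  ultimately show False using uncountable_ball[OF r(1), of a] countable_subset by blast
qed

lemma doubly_periodic_constant:
  assumes "Im \<tau> > 0" "f holomorphic_on UNIV" "\<And>z. f (z + 1) = f z" "\<And>z. f (z + \<tau>) = f z"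
  shows "f z = f w"
proof -
  have a: "f (v + of_int k) = f v" for v and k :: int
  proof (induction k rule: int_induct[where k = 0])
    case (step1 i)
    thus ?case using assms(3)[of "v + of_int i"] by (simp add: add_ac)
  next
    case (step2 i)
    thus ?case using assms(3)[of "v + of_int (i - 1)"] by (simp add: add_ac)
  qed auto
  have b: "f (v + \<tau> * of_int l) = f v" for v and l :: int
  proof (induction l rule: int_induct[where k = 0])
    case (step1 i)
    thus ?case using assms(4)[of "v + \<tau> * of_int i"] by (simp add: algebra_simps)
  next
    case (step2 i)
    thus ?case using assms(4)[of "v + \<tau> * of_int (i - 1)"] by (simp add: algebra_simps)
  qed auto
  have cont: "continuous_on A f" for A
    using assms(2) holomorphic_on_imp_continuous_on continuous_on_subset by blast
  have "bounded (f ` cball 0 (1 + norm \<tau>))"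
    by (intro compact_imp_bounded compact_continuous_image cont) auto
  moreover have "range f \<subseteq> f ` cball 0 (1 + norm \<tau>)"
  proof clarify
    fix v
    \<comment> \<open>Coordinates of \<open>v\<close> in the real basis 1, \<tau>: \<open>l\<close>
      and \<open>s\<close> are the integral and fractional parts of the coefficient of \<tau>,
      \<open>k\<close> and \<open>r\<close> those of the coefficient of 1. Every value of f is thus
      taken on a compact set.\<close>
    define l where "l = \<lfloor>Im v / Im \<tau>\<rfloor>"
    define s where "s = Im v / Im \<tau> - of_int l"
    define k where "k = \<lfloor>Re v - Re \<tau> * Im v / Im \<tau>\<rfloor>"
    define r where "r = Re v - Re \<tau> * Im v / Im \<tau> - of_int k"
    have rs: "0 \<le> s" "s \<le> 1" "0 \<le> r" "r \<le> 1"
      unfolding s_def r_def l_def k_def by linarith+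
    have v: "v = (of_real r + of_real s * \<tau>) + \<tau> * of_int l + of_int k"
      using assms(1) by (simp add: complex_eq_iff r_def s_def field_simps)
    have "f v = f (of_real r + of_real s * \<tau>)"
      by (subst v) (simp only: a b)
    moreover have "norm (of_real r + of_real s * \<tau>) \<le> 1 + norm \<tau>"
    proof -
      have "norm (of_real r + of_real s * \<tau>) \<le> r + s * norm \<tau>"
        using norm_triangle_ineq[of "of_real r" "of_real s * \<tau>"] rs by (simp add: norm_mult)
      also have "\<dots> \<le> 1 + 1 * norm \<tau>" using rs by (intro add_mono mult_right_mono) auto
      finally show ?thesis by simp
    qed
    ultimately show "f v \<in> f ` cball 0 (1 + norm \<tau>)" by (metis image_eqI mem_cball_0)
  qed
  ultimately have "bounded (range f)" by (rule bounded_subset)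
  from Liouville_theorem[OF assms(2) this] show ?thesis by (auto simp: constant_on_def)
qed

section \<open>Weierstrass' three-term identity\<close>

text \<open>The arguments p - c and p + c - S have a sum that does not involve c, so neither does
  the multiplier. This is why the three terms of Weierstrass' identity, as functions of p, can be
  added and divided by one another.\<close>

lemma theta_pair_plus_tau:
  assumes "Im \<tau> > 0"
  shows "theta \<tau> (p + \<tau> - c) * theta \<tau> (p + \<tau> + c - S) =
    exp (- (of_real pi * \<i> * (4 * p - 2 * S + 2 * \<tau>))) * (theta \<tau> (p - c) * theta \<tau> (p + c - S))"
proof -
  have "theta \<tau> (p + \<tau> - c) * theta \<tau> (p + \<tau> + c - S) =
     exp (- (of_real pi * \<i> * (2 * (p - c) + \<tau>))) * exp (- (of_real pi * \<i> * (2 * (p + c - S) + \<tau>))) *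
     (theta \<tau> (p - c) * theta \<tau> (p + c - S))"
    using theta_plus_tau[OF assms, of "p - c"] theta_plus_tau[OF assms, of "p + c - S"]
    by (simp add: algebra_simps)
  also have "exp (- (of_real pi * \<i> * (2 * (p - c) + \<tau>))) * exp (- (of_real pi * \<i> * (2 * (p + c - S) + \<tau>))) =
     exp (- (of_real pi * \<i> * (4 * p - 2 * S + 2 * \<tau>)))"
    by (simp add: algebra_simps flip: exp_add)
  finally show ?thesis .
qed

lemma theta_pair_plus_1:
  assumes "Im \<tau> > 0"
  shows "theta \<tau> (p + 1 - c) * theta \<tau> (p + 1 + c - S) = theta \<tau> (p - c) * theta \<tau> (p + c - S)"
  using theta_plus_1[OF assms, of "p - c"] theta_plus_1[OF assms, of "p + c - S"]
  by (simp add: algebra_simps)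

lemma theta_swap: "Im \<tau> > 0 \<Longrightarrow> theta \<tau> (a - b) = - theta \<tau> (b - a)"
  using theta_minus[of \<tau> "b - a"] by simp

text \<open>The left side E, as a function of p, vanishes at q and S - q, the zeros of
  \<open>\<phi> q\<close>, and has the same multipliers as \<open>\<phi> q\<close>. So E =
  \<open>\<phi> q\<close> * H with H entire and doubly periodic, hence constant; the further zero of
  E at r makes the constant 0. The first condition separates the zeros q and S - q modulo the
  lattice, the other two say that \<open>\<phi> q\<close> does not vanish at r.\<close>

lemma theta_weierstrass_generic:
  assumes "Im \<tau> > 0" "theta \<tau> (2 * q - S) \<noteq> 0" "theta \<tau> (r - q) \<noteq> 0" "theta \<tau> (r + q - S) \<noteq> 0"
  shows "theta \<tau> p * theta \<tau> (p - S) * theta \<tau> (q - r) * theta \<tau> (q + r - S) +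
         theta \<tau> q * theta \<tau> (q - S) * theta \<tau> (r - p) * theta \<tau> (r + p - S) +
         theta \<tau> r * theta \<tau> (r - S) * theta \<tau> (p - q) * theta \<tau> (p + q - S) = 0"
proof -
  define \<phi> where "\<phi> = (\<lambda>c p. theta \<tau> (p - c) * theta \<tau> (p + c - S))"
  define E where "E = (\<lambda>p. \<phi> 0 p * \<phi> r q - \<phi> 0 q * \<phi> r p + \<phi> 0 r * \<phi> q p)"
  have swap: "theta \<tau> (r - p) = - theta \<tau> (p - r)" for r p
    by (rule theta_swap[OF assms(1)])
  have E: "E p = theta \<tau> p * theta \<tau> (p - S) * theta \<tau> (q - r) * theta \<tau> (q + r - S) +
         theta \<tau> q * theta \<tau> (q - S) * theta \<tau> (r - p) * theta \<tau> (r + p - S) +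
         theta \<tau> r * theta \<tau> (r - S) * theta \<tau> (p - q) * theta \<tau> (p + q - S)" for p
    unfolding E_def \<phi>_def swap[of r p] by (simp add: algebra_simps)
  have hol\<phi>: "\<phi> c holomorphic_on UNIV" for c
    unfolding \<phi>_def by (intro holomorphic_intros assms)
  have holE: "E holomorphic_on UNIV"
    unfolding E_def by (intro holomorphic_intros hol\<phi>)
  define m where "m = (\<lambda>p. exp (- (of_real pi * \<i> * (4 * p - 2 * S + 2 * \<tau>))))"
  have \<phi>\<tau>: "\<phi> c (p + \<tau>) = m p * \<phi> c p" for c p
    unfolding \<phi>_def m_def by (rule theta_pair_plus_tau[OF assms(1)])
  have \<phi>1: "\<phi> c (p + 1) = \<phi> c p" for c p
    unfolding \<phi>_def by (rule theta_pair_plus_1[OF assms(1)])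
  have E\<tau>: "E (p + \<tau>) = m p * E p" for p
    unfolding E_def \<phi>\<tau> by (simp add: algebra_simps)
  have E1: "E (p + 1) = E p" for p
    unfolding E_def \<phi>1 by simp
  have E1': "E (p + of_int k) = E p" for p and k :: int
  proof (induction k rule: int_induct[where k = 0])
    case (step1 i)
    thus ?case using E1[of "p + of_int i"] by (simp add: add_ac)
  next
    case (step2 i)
    thus ?case using E1[of "p + of_int (i - 1)"] by (simp add: add_ac)
  qed auto
  have E\<tau>': "E (p + \<tau> * of_int l) = 0 \<longleftrightarrow> E p = 0" for p and l :: int
  proof (induction l rule: int_induct[where k = 0])
    case (step1 i)
    thus ?case using E\<tau>[of "p + \<tau> * of_int i"] by (simp add: algebra_simps m_def)
  next
    case (step2 i)
    thus ?case using E\<tau>[of "p + \<tau> * of_int (i - 1)"] by (simp add: algebra_simps m_def)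
  qed auto
  have Ez: "E p = 0" if "theta \<tau> (p - c) = 0" "E c = 0" for p c
  proof -
    from that(1) obtain k l where "p - c = of_int k + \<tau> * of_int l"
      unfolding theta_eq_0_iff[OF assms(1)] by blast
    hence "p = (c + \<tau> * of_int l) + of_int k" by (simp add: algebra_simps)
    with that(2) show ?thesis using E1' E\<tau>' by simp
  qed
  have th0: "theta \<tau> 0 = 0" by (rule theta_0[OF assms(1)])
  have Eq: "E q = 0" and ESq: "E (S - q) = 0" and Er: "E r = 0"
    unfolding E_def \<phi>_def
    using th0 theta_minus[OF assms(1), of q] theta_minus[OF assms(1), of r] swap[of q r] swap[of S q] swap[of S r] swap[of "S - q" r] by (simp_all add: algebra_simps)
  \<comment> \<open>E is divided by the two factors of \<open>\<phi> q\<close> in turn, each time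
    with the relevant zero moved to the origin: p = z + q here, p = z + S - q below.\<close>
  have hol1: "(\<lambda>z. E (z + q)) holomorphic_on UNIV"
    using holomorphic_on_compose_gen[OF _ holE, of "\<lambda>z. z + q" UNIV] by (simp add: o_def holomorphic_on_add)
  have zero1: "E (z + q) = 0" if "theta \<tau> z = 0" for z
    using Ez[of "z + q" q] that Eq by simp
  from holomorphic_divide_theta[OF assms(1) hol1 zero1]
  obtain h1 where "h1 holomorphic_on UNIV \<and> (\<forall>z. E (z + q) = theta \<tau> z * h1 z)" ..
  hence h1: "h1 holomorphic_on UNIV" "\<And>z. E (z + q) = theta \<tau> z * h1 z"
    by (blast, metis)
  have hol2: "(\<lambda>z. h1 (z + S - 2 * q)) holomorphic_on UNIV"
    using holomorphic_on_compose_gen[OF _ h1(1), of "\<lambda>z. z + S - 2 * q" UNIV]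
    by (simp add: o_def holomorphic_on_add holomorphic_on_diff)
  have zero2: "h1 (z + S - 2 * q) = 0" if z: "theta \<tau> z = 0" for z
  proof -
    have "E (z + S - q) = 0"
      using Ez[of "z + S - q" "S - q"] z ESq by (simp add: algebra_simps)
    hence "theta \<tau> (z + S - 2 * q) * h1 (z + S - 2 * q) = 0"
      using h1(2)[of "z + S - 2 * q"] by (simp add: algebra_simps)
    \<comment> \<open>The second division must not meet a zero of the first factor; a common zero
      would put 2 * q - S into the lattice.\<close>
    moreover have "theta \<tau> (z + S - 2 * q) \<noteq> 0"
    proof
      assume *: "theta \<tau> (z + S - 2 * q) = 0"
      from z obtain k l where kl: "z = of_int k + \<tau> * of_int l"
        unfolding theta_eq_0_iff[OF assms(1)] by blast
      from * obtain k' l' where "z + S - 2 * q = of_int k' + \<tau> * of_int l'"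
        unfolding theta_eq_0_iff[OF assms(1)] by blast
      hence "2 * q - S = of_int (k - k') + \<tau> * of_int (l - l')" by (simp add: kl algebra_simps)
      with assms(2) show False unfolding theta_eq_0_iff[OF assms(1)] by blast
    qed
    ultimately show ?thesis by simp
  qed
  from holomorphic_divide_theta[OF assms(1) hol2 zero2]
  obtain h2 where "h2 holomorphic_on UNIV \<and> (\<forall>z. h1 (z + S - 2 * q) = theta \<tau> z * h2 z)" ..
  hence h2: "h2 holomorphic_on UNIV" "\<And>z. h1 (z + S - 2 * q) = theta \<tau> z * h2 z"
    by (blast, metis)
  define H where "H = (\<lambda>p. h2 (p + q - S))"
  have EH: "E p = \<phi> q p * H p" for p
    using h1(2)[of "p - q"] h2(2)[of "p + q - S"] by (simp add: \<phi>_def H_def algebra_simps)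
  have holH: "H holomorphic_on UNIV"
    unfolding H_def using holomorphic_on_compose_gen[OF _ h2(1), of "\<lambda>z. z + q - S" UNIV]
    by (simp add: o_def holomorphic_on_add holomorphic_on_diff)
  have cH: "isCont (\<lambda>p. H (p + c)) z" for z c
  proof -
    have "isCont H (z + c)"
      using holH holomorphic_on_imp_continuous_on continuous_on_eq_continuous_at by blast
    moreover have "isCont (\<lambda>p. p + c) z" by (intro continuous_intros)
    ultimately show ?thesis by (rule isCont_o2[rotated])
  qed
  define B where "B = {p. \<phi> q p = 0}"
  have cB: "countable B"
  proof -
    have "B = {t. theta \<tau> (- q + 1 * t) = 0} \<union> {t. theta \<tau> (q - S + 1 * t) = 0}"
      by (auto simp: B_def \<phi>_def algebra_simps)
    thus ?thesis
      using countable_theta_zeros[OF assms(1), of 1 "- q"] countable_theta_zeros[OF assms(1), of 1 "q - S"]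
      by simp
  qed
  \<comment> \<open>Off the zeros of \<open>\<phi> q\<close>, H is a quotient of two functions with
    equal multipliers; the countable rest follows by continuity.\<close>
  have per: "H (p + c) = H p" if "\<And>p. \<exists>m. m \<noteq> 0 \<and> \<phi> q (p + c) = m * \<phi> q p \<and> E (p + c) = m * E p" for p c
  proof (rule isCont_eq_off_countable[where f = "\<lambda>p. H (p + c)" and g = H, OF _ _ cB])
    show "H (t + c) = H t" if t: "t \<notin> B" for t
    proof -
      obtain m where "m \<noteq> 0" "\<phi> q (t + c) = m * \<phi> q t" "E (t + c) = m * E t"
        using \<open>\<And>p. \<exists>m. m \<noteq> 0 \<and> \<phi> q (p + c) = m * \<phi> q p \<and> E (p + c) = m * E p\<close> by blast
      with EH[of "t + c"] EH[of t] t show ?thesis by (simp add: B_def)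
    qed
  qed (use cH[of p c] cH[of p 0] in auto)
  have "H p = H r"
  proof (rule doubly_periodic_constant[OF assms(1) holH])
    show "H (z + 1) = H z" for z
      by (rule per, rule exI[of _ 1]) (simp add: \<phi>1 E1)
    show "H (z + \<tau>) = H z" for z
    proof (rule per)
      show "\<exists>m. m \<noteq> 0 \<and> \<phi> q (p + \<tau>) = m * \<phi> q p \<and> E (p + \<tau>) = m * E p" for p
        by (rule exI[of _ "m p"]) (simp add: \<phi>\<tau> E\<tau>, simp add: m_def)
    qed
  qed
  also have "H r = 0"
    using EH[of r] Er assms(3,4) by (simp add: \<phi>_def)
  finally show ?thesis using EH[of p] E[of p] by simp
qed

text \<open>The three brackets that the generic case wants nonzero have only countably many zeros as
  functions of q, and the expression is continuous in q.\<close>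

lemma theta_weierstrass:
  assumes \<tau>: "Im \<tau> > 0"
  shows "theta \<tau> p * theta \<tau> (p - S) * theta \<tau> (q - r) * theta \<tau> (q + r - S) +
         theta \<tau> q * theta \<tau> (q - S) * theta \<tau> (r - p) * theta \<tau> (r + p - S) +
         theta \<tau> r * theta \<tau> (r - S) * theta \<tau> (p - q) * theta \<tau> (p + q - S) = 0"
proof (rule isCont_eq_off_countable[where a = q and g = "\<lambda>_. 0" and
   f = "\<lambda>q. theta \<tau> p * theta \<tau> (p - S) * theta \<tau> (q - r) * theta \<tau> (q + r - S) +
         theta \<tau> q * theta \<tau> (q - S) * theta \<tau> (r - p) * theta \<tau> (r + p - S) +
         theta \<tau> r * theta \<tau> (r - S) * theta \<tau> (p - q) * theta \<tau> (p + q - S)"])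
  let ?B = "{t. theta \<tau> (- S + 2 * t) = 0} \<union> {t. theta \<tau> (r + (- 1) * t) = 0} \<union> {t. theta \<tau> (r - S + 1 * t) = 0}"
  show "countable ?B"
    using countable_theta_zeros[OF \<tau>, of 2 "- S"] countable_theta_zeros[OF \<tau>, of "-1" r]
      countable_theta_zeros[OF \<tau>, of 1 "r - S"] by simp
  show "theta \<tau> p * theta \<tau> (p - S) * theta \<tau> (q - r) * theta \<tau> (q + r - S) +
         theta \<tau> q * theta \<tau> (q - S) * theta \<tau> (r - p) * theta \<tau> (r + p - S) +
         theta \<tau> r * theta \<tau> (r - S) * theta \<tau> (p - q) * theta \<tau> (p + q - S) = 0" if "q \<notin> ?B" for q
    using that by (intro theta_weierstrass_generic[OF \<tau>]) (auto simp: algebra_simps)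
qed (intro continuous_intros \<tau> | simp)+

section \<open>The Yang--Baxter equation\<close>

lemma br_weierstrass:
  assumes "Im \<tau> > 0"
  shows "br \<tau> \<eta> p * br \<tau> \<eta> (p - S) * br \<tau> \<eta> (q - r) * br \<tau> \<eta> (q + r - S) +
         br \<tau> \<eta> q * br \<tau> \<eta> (q - S) * br \<tau> \<eta> (r - p) * br \<tau> \<eta> (r + p - S) +
         br \<tau> \<eta> r * br \<tau> \<eta> (r - S) * br \<tau> \<eta> (p - q) * br \<tau> \<eta> (p + q - S) = 0"
  using theta_weierstrass[OF assms, of "\<eta> * p" "\<eta> * S" "\<eta> * q" "\<eta> * r"]
  by (simp add: br_eq_theta ring_distribs)

text \<open>The condition on \<eta> amounts to [1] \<noteq> 0. It also gives \<eta> \<noteq> 0, so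
  that the bracket of a nonconstant affine function has countably many zeros.\<close>

locale vsos =
  fixes \<tau> \<eta> :: complex
  assumes Im_tau: "Im \<tau> > 0"
    and eta_notin_lattice: "\<eta> \<notin> {of_int k + \<tau> * of_int l | k l. True}"
begin

abbreviation b :: "complex \<Rightarrow> complex" where "b \<equiv> br \<tau> \<eta>"

lemma eta_nonzero: "\<eta> \<noteq> 0"
proof
  assume "\<eta> = 0"
  hence "\<eta> = of_int 0 + \<tau> * of_int 0" by simp
  with eta_notin_lattice show False by blast
qed

lemma b_1_nonzero [simp]: "b 1 \<noteq> 0"
  using eta_notin_lattice by (auto simp: br_eq_theta theta_eq_0_iff[OF Im_tau])

lemma b_minus [simp]: "b (- x) = - b x"
  by (simp add: br_eq_theta Im_tau)

lemma b_0 [simp]: "b 0 = 0"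
  by (simp add: br_eq_theta Im_tau)

lemma b_swap: "b (x - y) = - b (y - x)"
  using b_minus[of "y - x"] by simp

lemma isCont_b [continuous_intros]: "isCont f z \<Longrightarrow> isCont (\<lambda>z. b (f z)) z"
  unfolding br_eq_theta by (intro continuous_intros Im_tau)

lemma countable_b_zeros: "c \<noteq> 0 \<Longrightarrow> countable {t. b (a + c * t) = 0}"
  using countable_theta_zeros[OF Im_tau, of "\<eta> * c" "\<eta> * a"] eta_nonzero
  by (simp add: br_eq_theta ring_distribs mult.assoc)

lemma br_same: "x = y \<Longrightarrow> b x = b y"
  by simp

lemma br_opposite: "x = - y \<Longrightarrow> b x = - b y"
  by simp

text \<open>Here each factor may be supplied with the sign and argument it has in the weights; the
  premises are then settled one by one by \<open>br_same\<close> or \<open>br_opposite\<close>,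
  without normalising a whole identity.\<close>

lemma br_weierstrass_eq:
  assumes "b p = P\<^sub>1" "b (p - S) = P\<^sub>2" "b (q - r) = P\<^sub>3" "b (q + r - S) = P\<^sub>4"
    and "b q = Q\<^sub>1" "b (q - S) = Q\<^sub>2" "b (r - p) = Q\<^sub>3" "b (r + p - S) = Q\<^sub>4"
    and "b r = R\<^sub>1" "b (r - S) = R\<^sub>2" "b (p - q) = R\<^sub>3" "b (p + q - S) = R\<^sub>4"
  shows "P\<^sub>1 * P\<^sub>2 * P\<^sub>3 * P\<^sub>4 + Q\<^sub>1 * Q\<^sub>2 * Q\<^sub>3 * Q\<^sub>4 + R\<^sub>1 * R\<^sub>2 * R\<^sub>3 * R\<^sub>4 = 0"
  using br_weierstrass[OF Im_tau, of \<eta> p S q r] unfolding assms .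

text \<open>The corners are read row by row, \<open>k l\<close> above \<open>m n\<close>. This frees
  the weight of a block from any state, so that hexagons of heights can be discussed.\<close>

definition w :: "complex \<Rightarrow> int \<Rightarrow> int \<Rightarrow> int \<Rightarrow> int \<Rightarrow> complex \<Rightarrow> complex" where
  "w lam k l m n u = Rweight \<tau> \<eta> (l - k) (n - l) (n - m) (m - k) (lam + of_int k) u"

definition nbrs :: "int \<Rightarrow> int \<Rightarrow> int set" where
  "nbrs a g = {e. \<bar>e - a\<bar> = 1 \<and> \<bar>e - g\<bar> = 1}"

lemma nbrs_eq:
  "nbrs a g = (if a = g then {a - 1, a + 1} else if g = a + 2 then {a + 1}
     else if g = a - 2 then {a - 1} else {})"
  by (auto simp: nbrs_def)

lemma w_shift: "w lam (A + k) (A + l) (A + m) (A + n) u = w (lam + of_int A) k l m n u"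
  by (simp add: w_def add.assoc)

text \<open>Reversal of all spins: the brackets that contain L come as one in the numerator and one
  in the denominator, and both change sign. The symmetry halves the case distinction for the
  Yang--Baxter equation.\<close>

lemma Rweight_flip: "Rweight \<tau> \<eta> (- k) (- l) (- m) (- n) (- L) u = Rweight \<tau> \<eta> k l m n L u"
proof -
  have *: "b (- L + 1) = - b (L - 1)" "b (- L - 1) = - b (L + 1)"
    "b (- L + u) = - b (L - u)" "b (- L - u) = - b (L + u)"
    by (rule br_opposite; simp)+
  have **: "- k = 1 \<longleftrightarrow> k = -1" "- k = -1 \<longleftrightarrow> k = 1" for k :: int
    by auto
  show ?thesis
    unfolding Rweight_def prod.inject * ** b_minus by auto
qed

lemma w_flip: "w (- lam) (- k) (- l) (- m) (- n) u = w lam k l m n u"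
  using Rweight_flip[of "l - k" "n - l" "n - m" "m - k" "lam + of_int k" u] by (simp add: w_def)

context
  fixes lam t v :: complex
  assumes nz': "\<And>k::int. b (lam + of_int k) \<noteq> 0"
begin

lemma nz: "b lam \<noteq> 0" "b (lam + 1) \<noteq> 0" "b (lam + 2) \<noteq> 0" "b (lam - 1) \<noteq> 0"
  using nz'[of 0] nz'[of 1] nz'[of 2] nz'[of "-1"] by simp_all

text \<open>The hexagon with corners \<open>0, 1, G, H, f, A\<close> gives the lemma \<open>face_ybe_G_H_f_A\<close>, where
  \<open>m\<close> stands for a minus sign. Only the hexagon \<open>0, 1, 0, 1, 0, 1\<close> needs two instances of
  Weierstrass' identity; the others need at most one.\<close>

lemma face_ybe_2_3_2_1:
  "w lam 0 1 1 2 (t + v) * w lam 1 2 2 3 t * w lam 1 2 2 3 v =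
   w lam 0 1 1 2 v * w lam 0 1 1 2 t * w lam 1 2 2 3 (t + v)"
  by (simp add: w_def Rweight_def mult_ac)

text \<open>The pattern of the cases with one instance: \<open>id\<close> is Weierstrass' identity
  for a suitable choice of p, q, r, S, and \<open>h0\<close>, \<open>h1\<close>, ... write each
  product of three weights as one common quotient times a term of \<open>id\<close>.\<close>

lemma face_ybe_2_1_0_1:
  "w lam 0 1 1 0 (t + v) * w lam 1 2 0 1 t * w lam 1 0 0 1 v + w lam 0 1 1 2 (t + v) * w lam 1 2 2 1 t * w lam 1 2 0 1 v =
   w lam 0 1 1 2 v * w lam 0 1 1 0 t * w lam 1 2 0 1 (t + v)"
proof -
  have "b 1 * b t * (- b (lam + v + 1)) * (- b (lam - t - v)) + (- b lam) * (- b (lam - t + 1)) * b v * b (t + v + 1) + b (v + 1) * b (t + v) * b (lam + 1) * (- b (lam - t)) = 0"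
    by (rule br_weierstrass_eq[where p = "1" and q = "- lam" and r = "v + 1" and S = "- t + 1"];
      (rule br_same | rule br_opposite); simp)
  hence id: "b 1 * b t * b (lam - t - v) * b (lam + v + 1) + b v * b (t + v + 1) * b (lam - t + 1) * b lam =
     b (v + 1) * b (t + v) * b (lam - t) * b (lam + 1)"
    by algebra
  have h0: "w lam 0 1 1 0 (t + v) * w lam 1 2 0 1 t * w lam 1 0 0 1 v =
     (b (lam + 2)) / (b 1 * b 1 * b lam * b (lam + 1) * b (lam + 1)) * (b 1 * b t * b (lam - t - v) * b (lam + v + 1))"
    using nz by (simp add: w_def Rweight_def) (simp add: field_simps)?
  have h1: "w lam 0 1 1 2 (t + v) * w lam 1 2 2 1 t * w lam 1 2 0 1 v =
     (b (lam + 2)) / (b 1 * b 1 * b lam * b (lam + 1) * b (lam + 1)) * (b v * b (t + v + 1) * b (lam - t + 1) * b lam)"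
    using nz by (simp add: w_def Rweight_def) (simp add: field_simps)?
  have h2: "w lam 0 1 1 2 v * w lam 0 1 1 0 t * w lam 1 2 0 1 (t + v) =
     (b (lam + 2)) / (b 1 * b 1 * b lam * b (lam + 1) * b (lam + 1)) * (b (v + 1) * b (t + v) * b (lam - t) * b (lam + 1))"
    using nz by (simp add: w_def Rweight_def) (simp add: field_simps)?
  show ?thesis
    by (simp only: h0 h1 h2 add_0_left add_0_right distrib_left[symmetric] id)
qed

lemma face_ybe_2_1_2_1:
  "w lam 0 1 1 0 (t + v) * w lam 1 2 0 1 t * w lam 1 0 2 1 v + w lam 0 1 1 2 (t + v) * w lam 1 2 2 1 t * w lam 1 2 2 1 v =
   w lam 0 1 1 2 v * w lam 0 1 1 2 t * w lam 1 2 2 1 (t + v)"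
proof -
  have "b v * (- b t) * (- b (lam + 2)) * b (lam - t - v) + (- b 1) * (- b (t + v + 1)) * b (lam - v + 1) * b (lam - t + 1) + b (lam + 1) * b (lam - t - v + 1) * b (v + 1) * (- b (t + 1)) = 0"
    by (rule br_weierstrass_eq[where p = "v" and q = "- 1" and r = "lam + 1" and S = "t + v"];
      (rule br_same | rule br_opposite); simp)
  hence id: "b v * b t * b (lam - t - v) * b (lam + 2) + b 1 * b (t + v + 1) * b (lam - t + 1) * b (lam - v + 1) =
     b (v + 1) * b (t + 1) * b (lam - t - v + 1) * b (lam + 1)"
    by algebra
  have h0: "w lam 0 1 1 0 (t + v) * w lam 1 2 0 1 t * w lam 1 0 2 1 v =
     (b lam) / (b 1 * b 1 * b lam * b (lam + 1) * b (lam + 1)) * (b v * b t * b (lam - t - v) * b (lam + 2))"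
    using nz by (simp add: w_def Rweight_def) (simp add: field_simps)?
  have h1: "w lam 0 1 1 2 (t + v) * w lam 1 2 2 1 t * w lam 1 2 2 1 v =
     (b lam) / (b 1 * b 1 * b lam * b (lam + 1) * b (lam + 1)) * (b 1 * b (t + v + 1) * b (lam - t + 1) * b (lam - v + 1))"
    using nz by (simp add: w_def Rweight_def) (simp add: field_simps)?
  have h2: "w lam 0 1 1 2 v * w lam 0 1 1 2 t * w lam 1 2 2 1 (t + v) =
     (b lam) / (b 1 * b 1 * b lam * b (lam + 1) * b (lam + 1)) * (b (v + 1) * b (t + 1) * b (lam - t - v + 1) * b (lam + 1))"
    using nz by (simp add: w_def Rweight_def) (simp add: field_simps)?
  show ?thesis
    by (simp only: h0 h1 h2 add_0_left add_0_right distrib_left[symmetric] id)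
qed

lemma face_ybe_2_1_0_m1:
  "w lam 0 1 (-1) 0 (t + v) * w lam 1 2 0 1 t * w lam (-1) 0 0 1 v =
   w lam 0 1 1 2 v * w lam 0 1 (-1) 0 t * w lam 1 2 0 1 (t + v)"
  by (simp add: w_def Rweight_def mult_ac)

lemma face_ybe_0_1_0_1:
  "w lam 0 1 1 0 (t + v) * w lam 1 0 0 1 t * w lam 1 0 0 1 v + w lam 0 1 1 2 (t + v) * w lam 1 0 2 1 t * w lam 1 2 0 1 v =
   w lam 0 1 (-1) 0 v * w lam 0 (-1) 1 0 t * w lam (-1) 0 0 1 (t + v) + w lam 0 1 1 0 v * w lam 0 1 1 0 t * w lam 1 0 0 1 (t + v)"
proof -
  have "b lam * b (lam - t - v) * (- b (lam + v + 1)) * (- b (lam + t + 1)) + (- b (lam + 1)) * (- b (lam + t + v + 1)) * (- b (lam - v)) * b (lam - t) + b v * (- b t) * b (2 * lam + 1) * (- b (t + v + 1)) = 0"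
    by (rule br_weierstrass_eq[where p = "lam" and q = "- lam - 1" and r = "v" and S = "t + v"];
      (rule br_same | rule br_opposite); simp)
  moreover have "b lam * b lam * b lam * b (lam + 2) + b (lam + 1) * b (lam + 1) * (- b (lam - 1)) * b (lam + 1) + b 1 * b 1 * (- b 1) * b (2 * lam + 1) = 0"
    by (rule br_weierstrass_eq[where p = "lam" and q = "lam + 1" and r = "1" and S = "0"];
      (rule br_same | rule br_opposite); simp)
  \<comment> \<open>Both instances contain \<open>b (2 * lam + 1)\<close>, which occurs in no
    weight; eliminating it leaves a relation between the four products.\<close>
  ultimately have id: "b 1 * b 1 * b 1 * b (lam - t - v) * b lam * b (lam + v + 1) * b (lam + t + 1) + b v * b t * b (t + v + 1) * b lam * b lam * b lam * b (lam + 2) =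
     b v * b t * b (t + v + 1) * b (lam - 1) * b (lam + 1) * b (lam + 1) * b (lam + 1) + b 1 * b 1 * b 1 * b (lam - t) * b (lam - v) * b (lam + 1) * b (lam + t + v + 1)"
    by algebra
  have h0: "w lam 0 1 1 0 (t + v) * w lam 1 0 0 1 t * w lam 1 0 0 1 v =
     (1) / (b 1 * b 1 * b 1 * b lam * b lam * b (lam + 1) * b (lam + 1)) * (b 1 * b 1 * b 1 * b (lam - t - v) * b lam * b (lam + v + 1) * b (lam + t + 1))"
    using nz by (simp add: w_def Rweight_def) (simp add: field_simps)?
  have h1: "w lam 0 1 1 2 (t + v) * w lam 1 0 2 1 t * w lam 1 2 0 1 v =
     (1) / (b 1 * b 1 * b 1 * b lam * b lam * b (lam + 1) * b (lam + 1)) * (b v * b t * b (t + v + 1) * b lam * b lam * b lam * b (lam + 2))"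
    using nz by (simp add: w_def Rweight_def) (simp add: field_simps)?
  have h2: "w lam 0 1 (-1) 0 v * w lam 0 (-1) 1 0 t * w lam (-1) 0 0 1 (t + v) =
     (1) / (b 1 * b 1 * b 1 * b lam * b lam * b (lam + 1) * b (lam + 1)) * (b v * b t * b (t + v + 1) * b (lam - 1) * b (lam + 1) * b (lam + 1) * b (lam + 1))"
    using nz by (simp add: w_def Rweight_def) (simp add: field_simps)?
  have h3: "w lam 0 1 1 0 v * w lam 0 1 1 0 t * w lam 1 0 0 1 (t + v) =
     (1) / (b 1 * b 1 * b 1 * b lam * b lam * b (lam + 1) * b (lam + 1)) * (b 1 * b 1 * b 1 * b (lam - t) * b (lam - v) * b (lam + 1) * b (lam + t + v + 1))"
    using nz by (simp add: w_def Rweight_def) (simp add: field_simps)?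
  show ?thesis
    by (simp only: h0 h1 h2 h3 add_0_left add_0_right distrib_left[symmetric] id)
qed

lemma face_ybe_0_1_2_1:
  "w lam 0 1 1 0 (t + v) * w lam 1 0 0 1 t * w lam 1 0 2 1 v + w lam 0 1 1 2 (t + v) * w lam 1 0 2 1 t * w lam 1 2 2 1 v =
   w lam 0 1 (-1) 0 v * w lam 0 (-1) 1 2 t * w lam (-1) 0 2 1 (t + v) + w lam 0 1 1 0 v * w lam 0 1 1 2 t * w lam 1 0 2 1 (t + v)"
proof -
  have "b 1 * b v * (- b (lam + t + 1)) * (- b (lam - t - v)) + (- b lam) * (- b (lam - v + 1)) * b t * b (t + v + 1) + b (t + 1) * b (t + v) * b (lam + 1) * (- b (lam - v)) = 0"
    by (rule br_weierstrass_eq[where p = "1" and q = "- lam" and r = "t + 1" and S = "- v + 1"];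
      (rule br_same | rule br_opposite); simp)
  hence id: "b 1 * b v * b (lam - t - v) * b (lam + t + 1) + b t * b (t + v + 1) * b (lam - v + 1) * b lam =
     b (t + 1) * b (t + v) * b (lam - v) * b (lam + 1)"
    by algebra
  have h0: "w lam 0 1 1 0 (t + v) * w lam 1 0 0 1 t * w lam 1 0 2 1 v =
     (b lam) / (b 1 * b 1 * b lam * b (lam + 1) * b (lam + 1)) * (b 1 * b v * b (lam - t - v) * b (lam + t + 1))"
    using nz by (simp add: w_def Rweight_def) (simp add: field_simps)?
  have h1: "w lam 0 1 1 2 (t + v) * w lam 1 0 2 1 t * w lam 1 2 2 1 v =
     (b lam) / (b 1 * b 1 * b lam * b (lam + 1) * b (lam + 1)) * (b t * b (t + v + 1) * b (lam - v + 1) * b lam)"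
    using nz by (simp add: w_def Rweight_def) (simp add: field_simps)?
  \<comment> \<open>The inner height -1 is adjacent to the two corners seen by \<open>nbrs\<close>
    but not to the third one, f = 2; the weight then has its default value 0.\<close>
  have h2: "w lam 0 1 (-1) 0 v * w lam 0 (-1) 1 2 t * w lam (-1) 0 2 1 (t + v) = 0"
    by (simp add: w_def Rweight_def)
  have h3: "w lam 0 1 1 0 v * w lam 0 1 1 2 t * w lam 1 0 2 1 (t + v) =
     (b lam) / (b 1 * b 1 * b lam * b (lam + 1) * b (lam + 1)) * (b (t + 1) * b (t + v) * b (lam - v) * b (lam + 1))"
    using nz by (simp add: w_def Rweight_def) (simp add: field_simps)?
  show ?thesis
    by (simp only: h0 h1 h2 h3 add_0_left add_0_right distrib_left[symmetric] id)
qed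

lemma face_ybe_0_m1_0_1:
  "w lam 0 1 1 0 (t + v) * w lam 1 0 0 (-1) t * w lam 1 0 0 (-1) v =
   w lam 0 1 (-1) 0 v * w lam 0 (-1) 1 0 t * w lam (-1) 0 0 (-1) (t + v) + w lam 0 1 1 0 v * w lam 0 1 1 0 t * w lam 1 0 0 (-1) (t + v)"
proof -
  have "b lam * b (lam - t - v) * b (v + 1) * (- b (t + 1)) + b v * (- b t) * (- b (lam + 1)) * b (lam - t - v - 1) + (- b 1) * (- b (t + v + 1)) * b (lam - v) * b (lam - t) = 0"
    by (rule br_weierstrass_eq[where p = "lam" and q = "v" and r = "- 1" and S = "t + v"];
      (rule br_same | rule br_opposite); simp)
  hence id: "b (v + 1) * b (t + 1) * b (lam - t - v) * b lam =
     b v * b t * b (lam - t - v - 1) * b (lam + 1) + b 1 * b (t + v + 1) * b (lam - t) * b (lam - v)"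
    by algebra
  have h0: "w lam 0 1 1 0 (t + v) * w lam 1 0 0 (-1) t * w lam 1 0 0 (-1) v =
     (b (lam - 1)) / (b 1 * b 1 * b (lam - 1) * b lam * b lam) * (b (v + 1) * b (t + 1) * b (lam - t - v) * b lam)"
    using nz by (simp add: w_def Rweight_def) (simp add: field_simps)?
  have h1: "w lam 0 1 (-1) 0 v * w lam 0 (-1) 1 0 t * w lam (-1) 0 0 (-1) (t + v) =
     (b (lam - 1)) / (b 1 * b 1 * b (lam - 1) * b lam * b lam) * (b v * b t * b (lam - t - v - 1) * b (lam + 1))"
    using nz by (simp add: w_def Rweight_def) (simp add: field_simps)?
  have h2: "w lam 0 1 1 0 v * w lam 0 1 1 0 t * w lam 1 0 0 (-1) (t + v) =
     (b (lam - 1)) / (b 1 * b 1 * b (lam - 1) * b lam * b lam) * (b 1 * b (t + v + 1) * b (lam - t) * b (lam - v))"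
    using nz by (simp add: w_def Rweight_def) (simp add: field_simps)?
  show ?thesis
    by (simp only: h0 h1 h2 add_0_left add_0_right distrib_left[symmetric] id)
qed

lemma face_ybe_0_1_0_m1:
  "w lam 0 1 (-1) 0 (t + v) * w lam 1 0 0 1 t * w lam (-1) 0 0 1 v =
   w lam 0 1 (-1) 0 v * w lam 0 (-1) (-1) 0 t * w lam (-1) 0 0 1 (t + v) + w lam 0 1 1 0 v * w lam 0 1 (-1) 0 t * w lam 1 0 0 1 (t + v)"
proof -
  have "b lam * b (lam + t + 1) * b (v + 1) * b (t + v) + b v * b (t + v + 1) * (- b (lam + 1)) * b (lam + t) + (- b 1) * b t * b (lam - v) * b (lam + t + v + 1) = 0"
    by (rule br_weierstrass_eq[where p = "lam" and q = "v" and r = "- 1" and S = "- t - 1"];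
      (rule br_same | rule br_opposite); simp)
  hence id: "b (v + 1) * b (t + v) * b lam * b (lam + t + 1) =
     b v * b (t + v + 1) * b (lam + 1) * b (lam + t) + b 1 * b t * b (lam - v) * b (lam + t + v + 1)"
    by algebra
  have h0: "w lam 0 1 (-1) 0 (t + v) * w lam 1 0 0 1 t * w lam (-1) 0 0 1 v =
     (b (lam + 1)) / (b 1 * b 1 * b lam * b lam * b (lam + 1)) * (b (v + 1) * b (t + v) * b lam * b (lam + t + 1))"
    using nz by (simp add: w_def Rweight_def) (simp add: field_simps)?
  have h1: "w lam 0 1 (-1) 0 v * w lam 0 (-1) (-1) 0 t * w lam (-1) 0 0 1 (t + v) =
     (b (lam + 1)) / (b 1 * b 1 * b lam * b lam * b (lam + 1)) * (b v * b (t + v + 1) * b (lam + 1) * b (lam + t))"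
    using nz by (simp add: w_def Rweight_def) (simp add: field_simps)?
  have h2: "w lam 0 1 1 0 v * w lam 0 1 (-1) 0 t * w lam 1 0 0 1 (t + v) =
     (b (lam + 1)) / (b 1 * b 1 * b lam * b lam * b (lam + 1)) * (b 1 * b t * b (lam - v) * b (lam + t + v + 1))"
    using nz by (simp add: w_def Rweight_def) (simp add: field_simps)?
  show ?thesis
    by (simp only: h0 h1 h2 add_0_left add_0_right distrib_left[symmetric] id)
qed

lemma face_ybe_0_m1_m2_m1:
  "w lam 0 1 (-1) (-2) (t + v) * w lam 1 0 (-2) (-1) t * w lam (-1) (-2) (-2) (-1) v + w lam 0 1 (-1) 0 (t + v) * w lam 1 0 0 (-1) t * w lam (-1) 0 (-2) (-1) v =
   w lam 0 1 (-1) 0 v * w lam 0 (-1) (-1) (-2) t * w lam (-1) 0 (-2) (-1) (t + v) + w lam 0 1 1 0 v * w lam 0 1 (-1) (-2) t * w lam 1 0 (-2) (-1) (t + v)"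
  by (simp add: w_def Rweight_def mult_ac)

lemma face_ybe_0_m1_0_m1:
  "w lam 0 1 (-1) (-2) (t + v) * w lam 1 0 (-2) (-1) t * w lam (-1) (-2) 0 (-1) v + w lam 0 1 (-1) 0 (t + v) * w lam 1 0 0 (-1) t * w lam (-1) 0 0 (-1) v =
   w lam 0 1 (-1) 0 v * w lam 0 (-1) (-1) 0 t * w lam (-1) 0 0 (-1) (t + v) + w lam 0 1 1 0 v * w lam 0 1 (-1) 0 t * w lam 1 0 0 (-1) (t + v)"
proof -
  have "b lam * b (lam - v - 1) * b (t + 1) * (- b (t + v)) + b 1 * (- b v) * (- b (lam + t)) * b (lam - t - v - 1) + (- b t) * (- b (t + v + 1)) * b (lam - 1) * b (lam - v) = 0"
    by (rule br_weierstrass_eq[where p = "lam" and q = "1" and r = "- t" and S = "v + 1"];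
      (rule br_same | rule br_opposite); simp)
  hence id: "b (t + 1) * b (t + v) * b (lam - v - 1) * b lam =
     b 1 * b v * b (lam - t - v - 1) * b (lam + t) + b t * b (t + v + 1) * b (lam - v) * b (lam - 1)"
    by algebra
  have h0: "w lam 0 1 (-1) (-2) (t + v) * w lam 1 0 (-2) (-1) t * w lam (-1) (-2) 0 (-1) v = 0"
    by (simp add: w_def Rweight_def)
  have h1: "w lam 0 1 (-1) 0 (t + v) * w lam 1 0 0 (-1) t * w lam (-1) 0 0 (-1) v =
     (b (lam + 1)) / (b 1 * b 1 * b (lam - 1) * b lam * b lam) * (b (t + 1) * b (t + v) * b (lam - v - 1) * b lam)"
    using nz by (simp add: w_def Rweight_def) (simp add: field_simps)?
  have h2: "w lam 0 1 (-1) 0 v * w lam 0 (-1) (-1) 0 t * w lam (-1) 0 0 (-1) (t + v) =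
     (b (lam + 1)) / (b 1 * b 1 * b (lam - 1) * b lam * b lam) * (b 1 * b v * b (lam - t - v - 1) * b (lam + t))"
    using nz by (simp add: w_def Rweight_def) (simp add: field_simps)?
  have h3: "w lam 0 1 1 0 v * w lam 0 1 (-1) 0 t * w lam 1 0 0 (-1) (t + v) =
     (b (lam + 1)) / (b 1 * b 1 * b (lam - 1) * b lam * b lam) * (b t * b (t + v + 1) * b (lam - v) * b (lam - 1))"
    using nz by (simp add: w_def Rweight_def) (simp add: field_simps)?
  show ?thesis
    by (simp only: h0 h1 h2 h3 add_0_left add_0_right distrib_left[symmetric] id)
qed

text \<open>The heights are normalised to a = 0 and e = 1, which leaves the ten hexagons treated
  above. The inner height runs over the common neighbours of two corners; its adjacency to the third
  is enforced by vanishing weights.\<close>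

lemma face_ybe_up:
  assumes "\<bar>A\<bar> = 1" "G = 0 \<or> G = 2" "\<bar>H - G\<bar> = 1" "f \<in> nbrs A H"
  shows "(\<Sum>e\<in>nbrs A H. w lam 0 1 A e (t + v) * w lam 1 G e H t * w lam A e f H v) =
    (\<Sum>e\<in>nbrs 0 G. w lam 0 1 e G v * w lam 0 e A f t * w lam e G f H (t + v))"
proof -
  have "A = 1 \<or> A = -1" "G = 0 \<and> (H = 1 \<or> H = -1) \<or> G = 2 \<and> (H = 1 \<or> H = 3)"
    using assms by auto
  thus ?thesis
    using assms(4)
    by (elim disjE conjE)
      (auto simp: nbrs_eq face_ybe_2_3_2_1 face_ybe_2_1_0_1 face_ybe_2_1_2_1 face_ybe_2_1_0_m1
        face_ybe_0_1_0_1 face_ybe_0_1_2_1 face_ybe_0_m1_0_1 face_ybe_0_1_0_m1 face_ybe_0_m1_m2_m1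
        face_ybe_0_m1_0_m1)
qed

end

text \<open>The dynamical Yang--Baxter equation on a hexagon with corners a, e, g, g', f, a'.
  Translating all heights by -a replaces \<open>lam\<close> by lam + a, and negating them replaces
  \<open>lam\<close> by -lam and turns e = a - 1 into e = a + 1. The auxiliary statement is
  therefore quantified over \<open>lam\<close> as well.\<close>

lemma face_ybe:
  assumes nz: "\<And>k::int. b (lam + of_int k) \<noteq> 0"
    and "\<bar>a' - a\<bar> = 1" "\<bar>g' - g\<bar> = 1" "e \<in> nbrs a g" "f \<in> nbrs a' g'"
  shows "(\<Sum>e'\<in>nbrs a' g'. w lam a e a' e' (t + v) * w lam e g e' g' t * w lam a' e' f g' v) =
    (\<Sum>f'\<in>nbrs a g. w lam a e f' g v * w lam a f' a' f t * w lam f' g f g' (t + v))"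
proof -
  have *: "(\<Sum>e'\<in>nbrs a' g'. w lam a e a' e' (t + v) * w lam e g e' g' t * w lam a' e' f g' v) =
    (\<Sum>f'\<in>nbrs a g. w lam a e f' g v * w lam a f' a' f t * w lam f' g f g' (t + v))"
    if "e - a = 1" and nz: "\<And>k::int. b (lam + of_int k) \<noteq> 0"
      and A: "\<bar>a' - a\<bar> = 1" "\<bar>g' - g\<bar> = 1" "e \<in> nbrs a g" "f \<in> nbrs a' g'"
    for lam a a' g g' e f
  proof -
    have sum: "sum F (nbrs k l) = (\<Sum>i\<in>nbrs (k - a) (l - a). F (a + i))" for F :: "int \<Rightarrow> complex" and k l
      by (rule sum.reindex_bij_witness[of _ "\<lambda>i. a + i" "\<lambda>i. i - a"]) (auto simp: nbrs_def)
    have w: "w lam k l m n u = w (lam + of_int a) (k - a) (l - a) (m - a) (n - a) u" for k l m n u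
      using w_shift[of lam a "k - a" "l - a" "m - a" "n - a" u] by simp
    have nz'': "b (lam + of_int a + of_int k) \<noteq> 0" for k :: int
      using nz[of "a + k"] by (simp add: add.assoc)
    have p: "\<bar>a' - a\<bar> = 1" "g - a = 0 \<or> g - a = 2" "\<bar>(g' - a) - (g - a)\<bar> = 1"
      "f - a \<in> nbrs (a' - a) (g' - a)"
      using A \<open>e - a = 1\<close> by (auto simp: nbrs_def)
    show ?thesis
      unfolding sum[of _ a' g'] sum[of _ a g] w
      using face_ybe_up[OF nz'' p] \<open>e - a = 1\<close> by simp
  qed
  show ?thesis
  proof (cases "e - a = 1")
    case True
    from *[OF this assms] show ?thesis .
  next
    case False
    have sum: "sum F (nbrs (- k) (- l)) = (\<Sum>i\<in>nbrs k l. F (- i))" for F :: "int \<Rightarrow> complex" and k l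
      by (rule sum.reindex_bij_witness[of _ uminus uminus]) (auto simp: nbrs_def)
    have nz'': "b (- lam + of_int k) \<noteq> 0" for k :: int
    proof -
      have "b (- lam + of_int k) = - b (lam + of_int (- k))" by (rule br_opposite) simp
      with nz[of "- k"] show ?thesis by simp
    qed
    have "- e - (- a) = 1" "\<bar>- a' - (- a)\<bar> = 1" "\<bar>- g' - (- g)\<bar> = 1"
      "- e \<in> nbrs (- a) (- g)" "- f \<in> nbrs (- a') (- g')"
      using assms(2-5) False by (auto simp: nbrs_def)
    from *[OF this(1) nz'' this(2-5)] show ?thesis
      unfolding sum w_flip .
  qed
qed

section \<open>Interpolation in the last row\<close>


text \<open>A node \<open>y m\<close> and a factor \<open>b (x - c)\<close> are added to a given
  interpolation formula. The three-term identity splits the k-th term of the enlarged sum into a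
  multiple of the old k-th term at x and a multiple of the old k-th term at \<open>y m\<close>; the
  given formula, used at both points, sums the two parts to \<open>P x\<close> and
  \<open>P (y m)\<close>.\<close>

lemma interpolation_step:
  fixes d :: "'i \<Rightarrow> complex" and y a :: "'i \<Rightarrow> complex"
  assumes "finite I" "m \<notin> I" "b s \<noteq> 0"
    and ym: "\<And>k. k \<in> I \<Longrightarrow> b (y k - y m) \<noteq> 0"
    and IH: "\<And>x. P x * b s = (\<Sum>k\<in>I. b (x - y k + s) * d k * (\<Prod>j\<in>I - {k}. b (x - y j)))"
  shows "P x * b (x - c) * b (s + y m - c) =
    (\<Sum>k\<in>I. b (x - y k + (s + y m - c)) * (d k * b (y k - c) / b (y k - y m)) * ((\<Prod>j\<in>I - {k}. b (x - y j)) * b (x - y m)))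
    + b (x - y m + (s + y m - c)) * (P (y m) * b (y m - c) / (\<Prod>j\<in>I. b (y m - y j))) * (\<Prod>j\<in>I. b (x - y j))"
proof -
  define s' where "s' = s + y m - c"
  define X where "X = (\<Prod>j\<in>I. b (x - y j))"
  define Xk where "Xk = (\<lambda>k. \<Prod>j\<in>I - {k}. b (x - y j))"
  define Y where "Y = (\<Prod>j\<in>I. b (y m - y j))"
  define Yk where "Yk = (\<lambda>k. \<Prod>j\<in>I - {k}. b (y m - y j))"
  have my: "b (y m - y k) \<noteq> 0" if "k \<in> I" for k
    using ym[OF that] b_swap[of "y m" "y k"] by simp
  have Y0: "Y \<noteq> 0" unfolding Y_def using my assms(1) by simp
  have Xk: "X = b (x - y k) * Xk k" and Yk: "Y = b (y m - y k) * Yk k" if "k \<in> I" for k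
    unfolding X_def Xk_def Y_def Yk_def using that assms(1) by (simp_all add: prod.remove)
  have trm: "b s * (b (x - y k + s') * (d k * b (y k - c) / b (y k - y m)) * (Xk k * b (x - y m))) =
     b (x - c) * b s' * (b (x - y k + s) * d k * Xk k)
     - b (y m - c) * b (x - y m + s') * X / Y * (b (y m - y k + s) * d k * Yk k)" if k: "k \<in> I" for k
  proof -
    have "b s * b (y k - c) * (- b (x - y m)) * (- b (x - y k + s')) +
      (- b (x - c)) * (- b (x - y k + s)) * (- b s') * b (y k - y m) +
      (- b (y m - c)) * (- b (y m - y k + s)) * b (x - y m + s') * (- b (x - y k)) = 0"
      by (rule br_weierstrass_eq[where p = s and q = "c - x" and r = "c - y m" and S = "s - y k + c"];
        (rule br_same | rule br_opposite); simp add: s'_def)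
    hence T: "b s * b (y k - c) * b (x - y k + s') * b (x - y m) =
       b s' * b (x - c) * b (x - y k + s) * b (y k - y m) +
       b (y m - c) * b (x - y m + s') * b (x - y k) * b (y m - y k + s)"
      by algebra
    have "b s * (b (x - y k + s') * (d k * b (y k - c) / b (y k - y m)) * (Xk k * b (x - y m))) =
      (b s * b (y k - c) * b (x - y k + s') * b (x - y m)) * (d k * Xk k / b (y k - y m))"
      by simp
    also have "\<dots> = b (x - c) * b s' * (b (x - y k + s) * d k * Xk k) +
       b (y m - c) * b (x - y m + s') * b (x - y k) * b (y m - y k + s) * d k * Xk k / b (y k - y m)"
      unfolding T using ym[OF k] by (simp add: field_simps)
    also have "b (y m - c) * b (x - y m + s') * b (x - y k) * b (y m - y k + s) * d k * Xk k / b (y k - y m) =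
       - (b (y m - c) * b (x - y m + s') * X / Y * (b (y m - y k + s) * d k * Yk k))"
    proof -
      have "Yk k \<noteq> 0" using Y0 Yk[OF k] by auto
      with ym[OF k] show ?thesis
        unfolding Xk[OF k] Yk[OF k] b_swap[of "y m" "y k"] by (simp add: field_simps)
    qed
    finally show ?thesis by simp
  qed
  have "b s * (\<Sum>k\<in>I. b (x - y k + s') * (d k * b (y k - c) / b (y k - y m)) * (Xk k * b (x - y m))) =
     b (x - c) * b s' * (\<Sum>k\<in>I. b (x - y k + s) * d k * Xk k)
     - b (y m - c) * b (x - y m + s') * X / Y * (\<Sum>k\<in>I. b (y m - y k + s) * d k * Yk k)"
    unfolding sum_distrib_left sum_subtractf[symmetric] by (rule sum.cong[OF refl trm])
  also have "\<dots> = b s * (P x * b (x - c) * b s' - b (x - y m + s') * (P (y m) * b (y m - c) / Y) * X)"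
    unfolding Xk_def Yk_def IH[symmetric] by (simp add: algebra_simps)
  finally show ?thesis
    using assms(3) unfolding s'_def[symmetric] X_def[symmetric] Y_def[symmetric] by (simp add: Xk_def)
qed

text \<open>Lagrange interpolation for theta functions. With s the sum of all y j - a j, the
  functions b(x - y k + s) times the product of b(x - y j) over j \<noteq> k have the same total
  shift as the product of b(x - a j), and at a node all but one of them vanish. The factor b(s)
  stands on the left instead of dividing the right, so that the formula also holds when b(s) =
  0.\<close>

lemma interpolation:
  fixes a y :: "'i \<Rightarrow> complex"
  assumes "finite I"
    and "\<And>i j. i \<in> I \<Longrightarrow> j \<in> I \<Longrightarrow> i \<noteq> j \<Longrightarrow> b (y i - y j) \<noteq> 0"
  shows "(\<Prod>j\<in>I. b (x - a j)) * b (\<Sum>j\<in>I. y j - a j) =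
    (\<Sum>k\<in>I. b (x - y k + (\<Sum>j\<in>I. y j - a j)) *
      ((\<Prod>j\<in>I. b (y k - a j)) / (\<Prod>j\<in>I - {k}. b (y k - y j))) * (\<Prod>j\<in>I - {k}. b (x - y j)))"
  using assms
proof (induction I arbitrary: a x rule: finite_induct)
  case empty
  show ?case by simp
next
  case (insert m I)
  show ?case
  proof (cases "I = {}")
    \<comment> \<open>Over an empty index set the sum of shifts is 0 and cannot be moved away from
      the zeros of \<open>b\<close>; with a single node the formula is immediate.\<close>
    case True
    thus ?thesis by simp
  next
    case False
    then obtain i where i: "i \<in> I" by blast
    have gen: "(\<Prod>j\<in>insert m I. b (x - a j)) * b (\<Sum>j\<in>insert m I. y j - a j) =
      (\<Sum>k\<in>insert m I. b (x - y k + (\<Sum>j\<in>insert m I. y j - a j)) *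
        ((\<Prod>j\<in>insert m I. b (y k - a j)) / (\<Prod>j\<in>insert m I - {k}. b (y k - y j))) *
        (\<Prod>j\<in>insert m I - {k}. b (x - y j)))"
      if s: "b (\<Sum>j\<in>I. y j - a j) \<noteq> 0" for a
    proof -
      define s where "s = (\<Sum>j\<in>I. y j - a j)"
      define d where "d = (\<lambda>k. (\<Prod>j\<in>I. b (y k - a j)) / (\<Prod>j\<in>I - {k}. b (y k - y j)))"
      have *: "(\<Prod>j\<in>I. b (x - a j)) * b s = (\<Sum>k\<in>I. b (x - y k + s) * d k * (\<Prod>j\<in>I - {k}. b (x - y j)))" for x
        unfolding s_def d_def using insert.prems by (intro insert.IH) auto
      have ins: "insert m I - {k} = insert m (I - {k})" if "k \<in> I" for k
        using that insert.hyps by auto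
      have ins': "insert m I - {m} = I" using insert.hyps by auto
      have "b (y k - y m) \<noteq> 0" if "k \<in> I" for k
        using insert.prems[of k m] that insert.hyps by auto
      note step = interpolation_step[OF insert.hyps s[folded s_def] this *, where c = "a m" and x = x]
      have ss: "(\<Sum>j\<in>insert m I. y j - a j) = s + y m - a m"
        using insert.hyps by (simp add: s_def)
      have "(\<Prod>j\<in>insert m I. b (x - a j)) * b (\<Sum>j\<in>insert m I. y j - a j) =
         (\<Prod>j\<in>I. b (x - a j)) * b (x - a m) * b (s + y m - a m)"
        unfolding ss using insert.hyps by simp
      also note step
      also have "(\<Sum>k\<in>I. b (x - y k + (s + y m - a m)) * (d k * b (y k - a m) / b (y k - y m)) *
          ((\<Prod>j\<in>I - {k}. b (x - y j)) * b (x - y m))) =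
        (\<Sum>k\<in>I. b (x - y k + (s + y m - a m)) *
        ((\<Prod>j\<in>insert m I. b (y k - a j)) / (\<Prod>j\<in>insert m I - {k}. b (y k - y j))) *
        (\<Prod>j\<in>insert m I - {k}. b (x - y j)))"
        using insert.hyps by (intro sum.cong refl) (simp add: ins d_def mult_ac)
      finally show ?thesis
        unfolding ss using insert.hyps by (simp add: ins' add.commute mult.commute)
    qed
    txt \<open>The induction step divides by \<open>b (\<Sum>j\<in>I. y j - a j)\<close>; moving \<open>a i\<close> makes it nonzero.\<close>
    define A where "A = (\<lambda>t. a(i := a i + t))"
    have A0: "A 0 = a" by (simp add: A_def)
    have cA: "isCont (\<lambda>t. A t j) z" for j z
      unfolding A_def by (cases "j = i") (auto intro!: continuous_intros)
    have nz: "(\<Prod>j\<in>insert m I - {k}. b (y k - y j)) \<noteq> 0" if "k \<in> insert m I" for k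
      using insert.hyps insert.prems that by (auto simp: prod_zero_iff)
    have sA: "(\<Sum>j\<in>I. y j - A t j) = (\<Sum>j\<in>I. y j - a j) + (- 1) * t" for t
    proof -
      have "(\<Sum>j\<in>I. y j - A t j) = (\<Sum>j\<in>I. (y j - a j) + (if j = i then - t else 0))"
        by (intro sum.cong) (auto simp: A_def)
      also have "\<dots> = (\<Sum>j\<in>I. y j - a j) - t"
        using insert.hyps i unfolding sum.distrib by (simp add: sum.delta)
      finally show ?thesis by simp
    qed
    let ?l = "\<lambda>t. (\<Prod>j\<in>insert m I. b (x - A t j)) * b (\<Sum>j\<in>insert m I. y j - A t j)"
    let ?r = "\<lambda>t. \<Sum>k\<in>insert m I. b (x - y k + (\<Sum>j\<in>insert m I. y j - A t j)) *
        ((\<Prod>j\<in>insert m I. b (y k - A t j)) / (\<Prod>j\<in>insert m I - {k}. b (y k - y j))) *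
        (\<Prod>j\<in>insert m I - {k}. b (x - y j))"
    have "?l 0 = ?r 0"
    proof (rule isCont_eq_off_countable[where f = ?l and g = ?r])
      show "countable {t. b ((\<Sum>j\<in>I. y j - a j) + (- 1) * t) = 0}"
        by (rule countable_b_zeros) simp
      show "isCont ?l 0"
        by (intro continuous_intros cA)
      show "isCont ?r 0"
        using nz by (intro continuous_intros cA) auto
      show "?l t = ?r t" if "t \<notin> {t. b ((\<Sum>j\<in>I. y j - a j) + (- 1) * t) = 0}" for t
        using that by (intro gen) (simp add: sA)
    qed
    thus ?thesis unfolding A0 .
  qed
qed

lemma block_weight_eq_w:
  "block_weight \<tau> \<eta> x y lam h i j =
    w lam (h (i - 1) (j - 1)) (h (i - 1) j) (h i (j - 1)) (h i j) (x i - y j)"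
  by (simp add: block_weight_def w_def Let_def)

text \<open>Every weight in the bottom row is a single bracket in the spectral parameter, shifted by a
  difference of values of \<open>\<phi>\<close> at neighbouring columns; so the shifts along the row telescope.\<close>

lemma w_bottom_row:
  fixes lam :: complex and k l d :: int
  assumes "\<bar>l - k\<bar> = 1" "\<bar>d + 1 - k\<bar> = 1" "\<bar>d - l\<bar> = 1"
  defines "\<phi> \<equiv> \<lambda>s e. if s = 1 then 0 else - lam - of_int e"
  shows "\<exists>K. \<forall>u. w lam k l (d + 1) d u = K * b (u + (\<phi> (d - l) d - \<phi> (d + 1 - k) (d + 1)))"
proof -
  \<comment> \<open>Heights fall along the last row, so only three block types occur. They
    contribute the shifts 0, - lam - d and 1.\<close>
  consider "k = d" "l = d - 1" | "k = d" "l = d + 1" | "k = d + 2" "l = d + 1"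
    using assms by linarith
  thus ?thesis
  proof cases
    case 1
    thus ?thesis by (auto simp: w_def Rweight_def \<phi>_def intro!: exI[of _ "b (lam + of_int d - 1) / (b 1 * b (lam + of_int d))"])
  next
    case 2
    have "b (lam + of_int d - u) = - b (u + (- lam - of_int d))" for u
      by (rule br_opposite) simp
    with 2 show ?thesis
      by (auto simp: w_def Rweight_def \<phi>_def diff_diff_eq intro!: exI[of _ "- 1 / b (lam + of_int d)"])
  next
    case 3
    thus ?thesis by (auto simp: w_def Rweight_def \<phi>_def intro!: exI[of _ "1 / b 1"])
  qed
qed

end

section \<open>Adjacency and boundary values of states\<close>

lemma states_vertical:
  assumes "h \<in> states n" "1 \<le> i" "i \<le> n" "j \<le> n"
  shows "\<bar>h i j - h (i - 1) j\<bar> = 1"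
proof -
  have "i - 1 < n" "i - 1 + 1 = i" using assms by auto
  with assms(1,4) show ?thesis unfolding states_def by force
qed

lemma states_horizontal:
  assumes "h \<in> states n" "i \<le> n" "1 \<le> j" "j \<le> n"
  shows "\<bar>h i j - h i (j - 1)\<bar> = 1"
proof -
  have "j - 1 < n" "j - 1 + 1 = j" using assms by auto
  with assms(1,2) show ?thesis unfolding states_def by force
qed

lemma states_boundary:
  assumes "h \<in> states n" "k \<le> n"
  shows "h 0 k = int k" "h k 0 = int k" "h n k = int n - int k" "h k n = int n - int k"
  using assms unfolding states_def by auto

context vsos
begin

text \<open>The shifts telescope to \<open>\<Phi> n - \<Phi> 0\<close>. The lower left corner is
  reached by a step up, so \<open>\<Phi> 0 = 0\<close>; the lower right corner has height 0 and is
  reached by a step down, so \<open>\<Phi> n = - lam\<close>. Only boundary heights enter, hence the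
  same interpolation formula serves all states and can be summed over them.\<close>

lemma bottom_row_interpolation:
  fixes lam :: complex
  assumes h: "h \<in> states n" and "n \<ge> 1"
    and y: "\<And>i j. i \<in> {1..n} \<Longrightarrow> j \<in> {1..n} \<Longrightarrow> i \<noteq> j \<Longrightarrow> b (y i - y j) \<noteq> 0"
  defines "R \<equiv> \<lambda>u. \<Prod>j=1..n. w lam (h (n - 1) (j - 1)) (h (n - 1) j) (h n (j - 1)) (h n j) (u - y j)"
  shows "R u * b lam = (\<Sum>k=1..n. b (lam - u + y k) *
    (R (y k) / (\<Prod>j\<in>{1..n} - {k}. b (y k - y j))) * (\<Prod>j\<in>{1..n} - {k}. b (u - y j)))"
proof -
  define \<Phi> where "\<Phi> = (\<lambda>j. if h n j - h (n - 1) j = 1 then 0 else - lam - of_int (h n j))"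
  have "\<exists>K. \<forall>u. w lam (h (n - 1) (j - 1)) (h (n - 1) j) (h n (j - 1)) (h n j) u =
      K * b (u + (\<Phi> j - \<Phi> (j - 1)))" if j: "j \<in> {1..n}" for j
  proof -
    have e: "h n (j - 1) = h n j + 1"
      using states_boundary(3)[OF h, of "j - 1"] states_boundary(3)[OF h, of j] j by auto
    show ?thesis
      unfolding \<Phi>_def e
      using states_vertical[OF h, of n j] states_vertical[OF h, of n "j - 1"]
        states_horizontal[OF h, of "n - 1" j] j
      by (intro w_bottom_row) (auto simp: e[unfolded One_nat_def])
  qed
  then obtain K where K: "w lam (h (n - 1) (j - 1)) (h (n - 1) j) (h n (j - 1)) (h n j) u =
      K j * b (u + (\<Phi> j - \<Phi> (j - 1)))" if "j \<in> {1..n}" for j u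
    by metis
  define a where "a = (\<lambda>j. y j - (\<Phi> j - \<Phi> (j - 1)))"
  define KK where "KK = (\<Prod>j=1..n. K j)"
  have R: "R u = KK * (\<Prod>j=1..n. b (u - a j))" for u
    unfolding R_def KK_def prod.distrib[symmetric]
  proof (intro prod.cong refl)
    fix j assume j: "j \<in> {1..n}"
    have "u - y j + (\<Phi> j - \<Phi> (j - 1)) = u - a j" by (simp add: a_def)
    thus "w lam (h (n - 1) (j - 1)) (h (n - 1) j) (h n (j - 1)) (h n j) (u - y j) = K j * b (u - a j)"
      by (simp only: K[OF j])
  qed
  have "(\<Sum>j=1..n. y j - a j) = (\<Sum>j=1..n. \<Phi> j - \<Phi> (j - 1))"
    by (simp add: a_def)
  also have "\<dots> = \<Phi> n - \<Phi> 0"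
    using sum_telescope''[of 0 n \<Phi>] by (simp flip: atLeastSucAtMost_greaterThanAtMost)
  also have "\<Phi> 0 = 0"
    using states_boundary(2)[OF h, of n] states_boundary(2)[OF h, of "n - 1"] \<open>n \<ge> 1\<close> by (simp add: \<Phi>_def of_nat_diff)
  also have "\<Phi> n = - lam"
    using states_boundary(4)[OF h, of n] states_boundary(4)[OF h, of "n - 1"] \<open>n \<ge> 1\<close> by (simp add: \<Phi>_def of_nat_diff)
  finally have s: "(\<Sum>j=1..n. y j - a j) = - lam" by simp
  have "R u * b lam = - (KK * ((\<Prod>j=1..n. b (u - a j)) * b (- lam)))"
    by (simp add: R)
  also have "(\<Prod>j=1..n. b (u - a j)) * b (- lam) =
    (\<Sum>k=1..n. b (u - y k + (- lam)) *
      ((\<Prod>j=1..n. b (y k - a j)) / (\<Prod>j\<in>{1..n} - {k}. b (y k - y j))) * (\<Prod>j\<in>{1..n} - {k}. b (u - y j)))"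
    unfolding s[symmetric] using y by (intro interpolation) auto
  also have "- (KK * \<dots>) = (\<Sum>k=1..n. b (lam - u + y k) *
    (R (y k) / (\<Prod>j\<in>{1..n} - {k}. b (y k - y j))) * (\<Prod>j\<in>{1..n} - {k}. b (u - y j)))"
    unfolding sum_distrib_left sum_negf[symmetric]
  proof (intro sum.cong refl)
    fix k
    have "b (u - y k + - lam) = - b (lam - u + y k)" by (rule br_opposite) simp
    thus "- (KK * (b (u - y k + - lam) * ((\<Prod>j=1..n. b (y k - a j)) / (\<Prod>j\<in>{1..n} - {k}. b (y k - y j))) *
        (\<Prod>j\<in>{1..n} - {k}. b (u - y j)))) = b (lam - u + y k) *
      (R (y k) / (\<Prod>j\<in>{1..n} - {k}. b (y k - y j))) * (\<Prod>j\<in>{1..n} - {k}. b (u - y j))"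
      by (simp add: R)
  qed
  finally show ?thesis .
qed

text \<open>The parameter \<open>x n\<close> enters only through the last row of blocks; the factor
  \<open>C h\<close> of the other rows passes through the interpolation unchanged.\<close>

lemma Zpart_interpolation:
  assumes "n \<ge> 1"
    and y: "\<And>i j. i \<in> {1..n} \<Longrightarrow> j \<in> {1..n} \<Longrightarrow> i \<noteq> j \<Longrightarrow> b (y i - y j) \<noteq> 0"
  shows "Zpart \<tau> \<eta> n x y lam * b lam = (\<Sum>k=1..n. b (lam - x n + y k) *
    (Zpart \<tau> \<eta> n (x(n := y k)) y lam / (\<Prod>j\<in>{1..n} - {k}. b (y k - y j))) *
    (\<Prod>j\<in>{1..n} - {k}. b (x n - y j)))"
proof -
  define R where "R = (\<lambda>h u. \<Prod>j=1..n. w lam (h (n - 1) (j - 1)) (h (n - 1) j) (h n (j - 1)) (h n j) (u - y j))"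
  define C where "C = (\<lambda>h. \<Prod>i=1..n-1. \<Prod>j=1..n. block_weight \<tau> \<eta> x y lam h i j)"
  have split: "{1..n} = insert n {1..n-1}" using \<open>n \<ge> 1\<close> by auto
  have Z: "Zpart \<tau> \<eta> n (x(n := u)) y lam = (\<Sum>h\<in>states n. C h * R h u)" for u
    unfolding Zpart_def
  proof (rule sum.cong[OF refl])
    fix h
    have "(\<Prod>i=1..n. \<Prod>j=1..n. block_weight \<tau> \<eta> (x(n := u)) y lam h i j) =
      (\<Prod>j=1..n. block_weight \<tau> \<eta> (x(n := u)) y lam h n j) *
      (\<Prod>i=1..n-1. \<Prod>j=1..n. block_weight \<tau> \<eta> (x(n := u)) y lam h i j)"
      using \<open>n \<ge> 1\<close> by (subst (1) split) (subst prod.insert, auto)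
    also have "(\<Prod>i=1..n-1. \<Prod>j=1..n. block_weight \<tau> \<eta> (x(n := u)) y lam h i j) = C h"
      unfolding C_def using \<open>n \<ge> 1\<close> by (intro prod.cong refl) (auto simp: block_weight_eq_w)
    finally show "(\<Prod>i=1..n. \<Prod>j=1..n. block_weight \<tau> \<eta> (x(n := u)) y lam h i j) = C h * R h u"
      by (simp add: R_def block_weight_eq_w)
  qed
  have "Zpart \<tau> \<eta> n x y lam * b lam = (\<Sum>h\<in>states n. C h * (R h (x n) * b lam))"
    using Z[of "x n"] by (simp add: sum_distrib_left mult_ac)
  also have "\<dots> = (\<Sum>h\<in>states n. \<Sum>k=1..n. b (lam - x n + y k) *
    (C h * R h (y k) / (\<Prod>j\<in>{1..n} - {k}. b (y k - y j))) * (\<Prod>j\<in>{1..n} - {k}. b (x n - y j)))"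
  proof (rule sum.cong[OF refl])
    fix h assume h: "h \<in> states n"
    show "C h * (R h (x n) * b lam) = (\<Sum>k=1..n. b (lam - x n + y k) *
      (C h * R h (y k) / (\<Prod>j\<in>{1..n} - {k}. b (y k - y j))) * (\<Prod>j\<in>{1..n} - {k}. b (x n - y j)))"
    proof -
      have "R h (x n) * b lam = (\<Sum>k=1..n. b (lam - x n + y k) *
          (R h (y k) / (\<Prod>j\<in>{1..n} - {k}. b (y k - y j))) * (\<Prod>j\<in>{1..n} - {k}. b (x n - y j)))"
        unfolding R_def using y by (intro bottom_row_interpolation h \<open>n \<ge> 1\<close>)
      thus ?thesis by (simp add: sum_distrib_left mult_ac)
    qed
  qed
  also have "\<dots> = (\<Sum>k=1..n. \<Sum>h\<in>states n. b (lam - x n + y k) *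
    (C h * R h (y k) / (\<Prod>j\<in>{1..n} - {k}. b (y k - y j))) * (\<Prod>j\<in>{1..n} - {k}. b (x n - y j)))"
    by (rule sum.swap)
  also have "\<dots> = (\<Sum>k=1..n. b (lam - x n + y k) *
    (Zpart \<tau> \<eta> n (x(n := y k)) y lam / (\<Prod>j\<in>{1..n} - {k}. b (y k - y j))) *
    (\<Prod>j\<in>{1..n} - {k}. b (x n - y j)))"
    unfolding Z by (simp add: sum_distrib_left sum_distrib_right sum_divide_distrib)
  finally show ?thesis .
qed

end

section \<open>Symmetry in the column parameters\<close>

text \<open>The possible fillings of one column of heights between two fixed ones. Consecutive
  heights need not be adjacent, which keeps the conditions at different positions independent; the
  value 0 beyond m represents each filling once.\<close>

definition chains :: "(nat \<Rightarrow> int set) \<Rightarrow> int \<Rightarrow> nat \<Rightarrow> int \<Rightarrow> (nat \<Rightarrow> int) set" where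
  "chains N p\<^sub>0 m e = {p. p 0 = p\<^sub>0 \<and> p m = e \<and> (\<forall>i>m. p i = 0) \<and> (\<forall>i\<le>m. p i \<in> N i)}"

lemma finite_chains:
  assumes "\<And>i. finite (N i)"
  shows "finite (chains N p\<^sub>0 m e)"
proof (rule finite_subset)
  let ?B = "\<Union>i\<in>{..m}. N i"
  show "chains N p\<^sub>0 m e \<subseteq> {p. \<forall>i. (i \<in> {..m} \<longrightarrow> p i \<in> ?B) \<and> (i \<notin> {..m} \<longrightarrow> p i = 0)}"
    unfolding chains_def by (auto simp: not_le)
  show "finite {p. \<forall>i. (i \<in> {..m} \<longrightarrow> p i \<in> ?B) \<and> (i \<notin> {..m} \<longrightarrow> p i = 0)}"
    using assms by (intro finite_set_of_finite_funs) auto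
qed

text \<open>This is an entry of the product of the matrices \<omega> 0, ..., \<omega> (m - 1), with
  rows and columns indexed by the sets \<open>N i\<close>.\<close>

definition chain_sum ::
  "(nat \<Rightarrow> int set) \<Rightarrow> int \<Rightarrow> (nat \<Rightarrow> int \<Rightarrow> int \<Rightarrow> complex) \<Rightarrow> nat \<Rightarrow> int \<Rightarrow> complex" where
  "chain_sum N p\<^sub>0 \<omega> m e = (\<Sum>p\<in>chains N p\<^sub>0 m e. \<Prod>i<m. \<omega> i (p i) (p (Suc i)))"

lemma chain_sum_0: "p\<^sub>0 \<in> N 0 \<Longrightarrow> chain_sum N p\<^sub>0 \<omega> 0 p\<^sub>0 = 1"
proof -
  assume "p\<^sub>0 \<in> N 0"
  hence "chains N p\<^sub>0 0 p\<^sub>0 = {\<lambda>i. if i = 0 then p\<^sub>0 else 0}"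
    by (auto simp: chains_def fun_eq_iff)
  thus ?thesis by (simp add: chain_sum_def)
qed

lemma chain_sum_Suc:
  assumes fin: "\<And>i. finite (N i)" and e: "e \<in> N (Suc m)"
  shows "chain_sum N p\<^sub>0 \<omega> (Suc m) e = (\<Sum>e'\<in>N m. chain_sum N p\<^sub>0 \<omega> m e' * \<omega> m e' e)"
proof -
  have "(\<Sum>e'\<in>N m. chain_sum N p\<^sub>0 \<omega> m e' * \<omega> m e' e) =
    (\<Sum>(e', p)\<in>Sigma (N m) (chains N p\<^sub>0 m). (\<Prod>i<m. \<omega> i (p i) (p (Suc i))) * \<omega> m e' e)"
    unfolding chain_sum_def sum_distrib_right using fin finite_chains[OF fin] by (subst sum.Sigma) auto
  also have "\<dots> = chain_sum N p\<^sub>0 \<omega> (Suc m) e"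
    unfolding chain_sum_def
  proof (rule sum.reindex_bij_witness[of _ "\<lambda>p. (p m, p(Suc m := 0))" "\<lambda>(e', p). p(Suc m := e)"])
    fix z assume "z \<in> Sigma (N m) (chains N p\<^sub>0 m)"
    then obtain e' p where z: "z = (e', p)" and e': "e' \<in> N m" and p: "p \<in> chains N p\<^sub>0 m e'" by auto
    from p have "p (Suc m) = 0" by (auto simp: chains_def)
    with p show "(case z of (e', p) \<Rightarrow> p(Suc m := e)) \<in> chains N p\<^sub>0 (Suc m) e"
      and "((case z of (e', p) \<Rightarrow> p(Suc m := e)) m, (case z of (e', p) \<Rightarrow> p(Suc m := e))(Suc m := 0)) = z"
      using e by (auto simp: z chains_def le_Suc_eq)
    show "(\<Prod>i<Suc m. \<omega> i ((case z of (e', p) \<Rightarrow> p(Suc m := e)) i) ((case z of (e', p) \<Rightarrow> p(Suc m := e)) (Suc i))) =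
       (case z of (e', p) \<Rightarrow> (\<Prod>i<m. \<omega> i (p i) (p (Suc i))) * \<omega> m e' e)"
      using p by (auto simp: z chains_def intro!: prod.cong)
  next
    fix p assume "p \<in> chains N p\<^sub>0 (Suc m) e"
    thus "(case (p m, p(Suc m := 0)) of (e', p) \<Rightarrow> p(Suc m := e)) = p"
      and "(p m, p(Suc m := 0)) \<in> Sigma (N m) (chains N p\<^sub>0 m)"
      by (auto simp: chains_def)
  qed
  finally show ?thesis by simp
qed

text \<open>In matrix form \<open>comm\<close> says \<omega>(i) M(i+1) = M(i) \<omega>'(i), so M can
  be pulled from the lower end of the product to the upper end, where it is the scalar
  \<open>M 0 p\<^sub>0 p\<^sub>0\<close> because \<open>N 0\<close> has a single element.\<close>

lemma chain_sum_intertwine: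
  assumes fin: "\<And>i. finite (N i)" and N0: "N 0 = {p\<^sub>0}"
    and comm: "\<And>i e f. i < n \<Longrightarrow> e \<in> N i \<Longrightarrow> f \<in> N (Suc i) \<Longrightarrow>
      (\<Sum>e'\<in>N (Suc i). \<omega> i e e' * M (Suc i) e' f) = (\<Sum>f'\<in>N i. M i e f' * \<omega>' i f' f)"
    and "m \<le> n" "f \<in> N m"
  shows "(\<Sum>e\<in>N m. chain_sum N p\<^sub>0 \<omega> m e * M m e f) = M 0 p\<^sub>0 p\<^sub>0 * chain_sum N p\<^sub>0 \<omega>' m f"
  using assms(4,5)
proof (induction m arbitrary: f)
  case 0
  thus ?case by (simp add: N0 chain_sum_0)
next
  case (Suc m)
  have "(\<Sum>e\<in>N (Suc m). chain_sum N p\<^sub>0 \<omega> (Suc m) e * M (Suc m) e f) =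
    (\<Sum>e\<in>N (Suc m). \<Sum>e'\<in>N m. chain_sum N p\<^sub>0 \<omega> m e' * (\<omega> m e' e * M (Suc m) e f))"
    by (intro sum.cong refl) (simp add: chain_sum_Suc[OF fin] sum_distrib_left mult_ac)
  also have "\<dots> = (\<Sum>e'\<in>N m. chain_sum N p\<^sub>0 \<omega> m e' * (\<Sum>e\<in>N (Suc m). \<omega> m e' e * M (Suc m) e f))"
    unfolding sum_distrib_left by (rule sum.swap)
  also have "\<dots> = (\<Sum>e'\<in>N m. chain_sum N p\<^sub>0 \<omega> m e' * (\<Sum>f'\<in>N m. M m e' f' * \<omega>' m f' f))"
    using Suc.prems by (intro sum.cong refl arg_cong2[where f = "(*)"] comm) auto
  also have "\<dots> = (\<Sum>f'\<in>N m. \<Sum>e'\<in>N m. chain_sum N p\<^sub>0 \<omega> m e' * (M m e' f' * \<omega>' m f' f))"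
    unfolding sum_distrib_left by (rule sum.swap)
  also have "\<dots> = (\<Sum>f'\<in>N m. (\<Sum>e'\<in>N m. chain_sum N p\<^sub>0 \<omega> m e' * M m e' f') * \<omega>' m f' f)"
    by (simp add: sum_distrib_left mult_ac)
  also have "\<dots> = (\<Sum>f'\<in>N m. M 0 p\<^sub>0 p\<^sub>0 * chain_sum N p\<^sub>0 \<omega>' m f' * \<omega>' m f' f)"
    using Suc by (intro sum.cong refl) simp
  also have "\<dots> = M 0 p\<^sub>0 p\<^sub>0 * chain_sum N p\<^sub>0 \<omega>' (Suc m) f"
    using Suc.prems by (simp add: chain_sum_Suc[OF fin] sum_distrib_left mult_ac)
  finally show ?case .
qed

section \<open>Bounds on the heights and finiteness of the set of states\<close>

lemma unit_steps_bound:
  fixes f :: "nat \<Rightarrow> int"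
  assumes "\<And>i. m \<le> i \<Longrightarrow> i < n \<Longrightarrow> \<bar>f (Suc i) - f i\<bar> = 1" "m \<le> n"
  shows "\<bar>f n - f m\<bar> \<le> int n - int m"
  using assms(2,1)
proof (induction n rule: dec_induct)
  case (step n)
  have "\<bar>f n - f m\<bar> \<le> int n - int m" using step by auto
  moreover have "\<bar>f (Suc n) - f n\<bar> = 1" using step by auto
  ultimately show ?case by linarith
qed simp

lemma states_row_bound:
  assumes h: "h \<in> states n" and "i \<le> n" "j \<le> j'" "j' \<le> n"
  shows "\<bar>h i j' - h i j\<bar> \<le> int j' - int j"
proof (rule unit_steps_bound)
  show "\<bar>h i (Suc k) - h i k\<bar> = 1" if "j \<le> k" "k < j'" for k
    using states_horizontal[OF h, of i "Suc k"] that assms by auto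
qed fact

lemma states_column_bound:
  assumes h: "h \<in> states n" and "j \<le> n" "i \<le> i'" "i' \<le> n"
  shows "\<bar>h i' j - h i j\<bar> \<le> int i' - int i"
proof (rule unit_steps_bound)
  show "\<bar>h (Suc k) j - h k j\<bar> = 1" if "i \<le> k" "k < i'" for k
    using states_vertical[OF h, of "Suc k" j] that assms by auto
qed fact

text \<open>The height differs from i by at most j (left side) and from n - i by at most n - j
  (right side). Nonnegativity is the mean of the two lower bounds i - j and j - i.\<close>

lemma states_bounds:
  assumes h: "h \<in> states n" and "i \<le> n" "j \<le> n"
  shows "0 \<le> h i j" "h i j \<le> int i + int j" "h i j \<le> 2 * int n - int i - int j"
  using states_row_bound[OF h, of i 0 j] states_row_bound[OF h, of i j n]
    states_column_bound[OF h, of j i n] states_boundary[OF h, of i] states_boundary[OF h, of j] assms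
  by linarith+

lemma finite_states: "finite (states n)"
proof (rule finite_imageD)
  let ?f = "\<lambda>h (i, j). h i j :: int"
  have "?f ` states n \<subseteq> {f. \<forall>x. (x \<in> {0..n} \<times> {0..n} \<longrightarrow> f x \<in> {0..2 * int n}) \<and> (x \<notin> {0..n} \<times> {0..n} \<longrightarrow> f x = 0)}"
  proof clarify
    fix h i j assume h: "h \<in> states n"
    have "h i j \<in> {0..2 * int n}" if "i \<le> n" "j \<le> n"
      using states_bounds[OF h that] that by auto
    moreover have "h i j = 0" if "i > n \<or> j > n"
      using h that unfolding states_def by blast
    ultimately show "((i, j) \<in> {0..n} \<times> {0..n} \<longrightarrow> h i j \<in> {0..2 * int n}) \<and> ((i, j) \<notin> {0..n} \<times> {0..n} \<longrightarrow> h i j = 0)"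
      by (auto simp: not_le)
  qed
  thus "finite (?f ` states n)"
    by (rule finite_subset) (intro finite_set_of_finite_funs finite_cartesian_product finite_atLeastAtMost finite_atLeastAtMost_int)
  show "inj_on ?f (states n)"
    by (auto simp: inj_on_def fun_eq_iff)
qed

context vsos
begin

lemma finite_nbrs: "finite (nbrs a g)"
  by (simp add: nbrs_eq)

text \<open>This lets sums over one column run over all of \<open>chains\<close>, including fillings
  with forbidden vertical steps.\<close>

lemma w_eq_0: "\<bar>n - l\<bar> \<noteq> 1 \<Longrightarrow> w lam k l m n u = 0"
  by (auto simp: w_def Rweight_def)

text \<open>Two neighbouring columns of blocks with outer heights \<alpha> and \<gamma>, summed over
  the heights between them. A face \<open>M\<close> with spectral parameter y' - y is pushed through
  by the Yang--Baxter equation and exchanges y and y'. At both ends \<alpha> and \<gamma> differ by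
  2, so the inner height is forced and \<open>M\<close> is \<open>b (y' - y + 1) / b 1\<close>
  there; this common factor cancels.\<close>

lemma column_pair_swap:
  fixes x :: "nat \<Rightarrow> complex" and lam :: complex
  assumes nz: "\<And>k::int. b (lam + of_int k) \<noteq> 0" and y: "b (y' - y + 1) \<noteq> 0"
    and \<alpha>: "\<And>i. i < n \<Longrightarrow> \<bar>\<alpha> (Suc i) - \<alpha> i\<bar> = 1" and \<gamma>: "\<And>i. i < n \<Longrightarrow> \<bar>\<gamma> (Suc i) - \<gamma> i\<bar> = 1"
    and ends: "\<alpha> 0 + 2 = \<gamma> 0" "\<alpha> n = \<gamma> n + 2"
  defines "\<omega> \<equiv> \<lambda>y y' i e e'. w lam (\<alpha> i) e (\<alpha> (Suc i)) e' (x (Suc i) - y) * w lam e (\<gamma> i) e' (\<gamma> (Suc i)) (x (Suc i) - y')"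
  defines "N \<equiv> \<lambda>i. nbrs (\<alpha> i) (\<gamma> i)"
  shows "chain_sum N (\<alpha> 0 + 1) (\<omega> y y') n (\<gamma> n + 1) = chain_sum N (\<alpha> 0 + 1) (\<omega> y' y) n (\<gamma> n + 1)"
proof -
  define M where "M = (\<lambda>i e f. w lam (\<alpha> i) e f (\<gamma> i) (y' - y))"
  have N0: "N 0 = {\<alpha> 0 + 1}" and Nn: "N n = {\<gamma> n + 1}"
    using ends by (simp_all add: N_def nbrs_eq)
  have comm: "(\<Sum>e'\<in>N (Suc i). \<omega> y y' i e e' * M (Suc i) e' f) = (\<Sum>f'\<in>N i. M i e f' * \<omega> y' y i f' f)"
    if "i < n" "e \<in> N i" "f \<in> N (Suc i)" for i e f
    using face_ybe[OF nz \<alpha>[OF that(1)] \<gamma>[OF that(1)] that(2,3)[unfolded N_def], of "x (Suc i) - y'" "y' - y"]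
    by (simp add: N_def \<omega>_def M_def mult_ac)
  have fin: "finite (N i)" for i by (simp add: N_def finite_nbrs)
  have "(\<Sum>e\<in>N n. chain_sum N (\<alpha> 0 + 1) (\<omega> y y') n e * M n e (\<gamma> n + 1)) =
     M 0 (\<alpha> 0 + 1) (\<alpha> 0 + 1) * chain_sum N (\<alpha> 0 + 1) (\<omega> y' y) n (\<gamma> n + 1)"
    by (rule chain_sum_intertwine[OF fin N0 comm order_refl]) (simp_all add: Nn)
  moreover have "M 0 (\<alpha> 0 + 1) (\<alpha> 0 + 1) = b (y' - y + 1) / b 1" "M n (\<gamma> n + 1) (\<gamma> n + 1) = b (y' - y + 1) / b 1"
    using ends by (simp_all add: M_def w_def Rweight_def flip: ends(1))
  ultimately show ?thesis using y by (simp add: Nn)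
qed

text \<open>Column k of the heights lies between the block columns with parameters
  \<open>y k\<close> and \<open>y (Suc k)\<close>. The states are grouped by their heights outside
  column k; on each group the weight is a constant times a chain sum, and the domain wall values at
  the top and bottom give the end conditions of \<open>column_pair_swap\<close>.\<close>

lemma Zpart_swap_adjacent:
  assumes nz: "\<And>k::int. b (lam + of_int k) \<noteq> 0" and k: "1 \<le> k" "k < n"
    and y: "b (y (Suc k) - y k + 1) \<noteq> 0"
  shows "Zpart \<tau> \<eta> n x (y \<circ> Transposition.transpose k (Suc k)) lam = Zpart \<tau> \<eta> n x y lam"
proof -
  define \<pi> where "\<pi> = (\<lambda>h::nat \<Rightarrow> nat \<Rightarrow> int. \<lambda>i j. if j = k then 0 else h i j)"
  define f where "f = (\<lambda>y h. \<Prod>i=1..n. \<Prod>j=1..n. block_weight \<tau> \<eta> x y lam h i j)"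
  define y' where "y' = y \<circ> Transposition.transpose k (Suc k)"
  have fibre: "(\<Sum>h\<in>{h \<in> states n. \<pi> h = \<pi> g}. f y h) = (\<Sum>h\<in>{h \<in> states n. \<pi> h = \<pi> g}. f y' h)"
    if g: "g \<in> states n" for g
  proof -
    define \<alpha> where "\<alpha> = (\<lambda>i. g i (k - 1))"
    define \<gamma> where "\<gamma> = (\<lambda>i. g i (Suc k))"
    define N where "N = (\<lambda>i. nbrs (\<alpha> i) (\<gamma> i))"
    define \<omega> where "\<omega> = (\<lambda>y y' i e e'. w lam (\<alpha> i) e (\<alpha> (Suc i)) e' (x (Suc i) - y) * w lam e (\<gamma> i) e' (\<gamma> (Suc i)) (x (Suc i) - y'))"
    define C where "C = (\<Prod>i=1..n. \<Prod>j\<in>{1..n} - {k, Suc k}. block_weight \<tau> \<eta> x y lam g i j)"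
    have bd: "\<alpha> 0 = int k - 1" "\<gamma> 0 = int k + 1" "\<alpha> n = int n - int k + 1" "\<gamma> n = int n - int k - 1"
      using k states_boundary(1,3)[OF g, of "k - 1"] states_boundary(1,3)[OF g, of "Suc k"]
      by (auto simp: \<alpha>_def \<gamma>_def of_nat_diff)
    have \<alpha>: "\<bar>\<alpha> (Suc i) - \<alpha> i\<bar> = 1" and \<gamma>: "\<bar>\<gamma> (Suc i) - \<gamma> i\<bar> = 1" if "i < n" for i
      using states_vertical[OF g, of "Suc i"] k that by (auto simp: \<alpha>_def \<gamma>_def)
    have weight: "f z h = C * (\<Prod>i<n. \<omega> (z k) (z (Suc k)) i (h i k) (h (Suc i) k))"
      if h: "\<pi> h = \<pi> g" and z: "\<And>j. j \<noteq> k \<Longrightarrow> j \<noteq> Suc k \<Longrightarrow> z j = y j" for z h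
    proof -
      have hg: "h i j = g i j" if "j \<noteq> k" for i j
        using fun_cong[OF fun_cong[OF h], of i j] that by (simp add: \<pi>_def)
      have split: "prod F {1..n} = F k * F (Suc k) * prod F ({1..n} - {k, Suc k})" for F :: "nat \<Rightarrow> complex"
      proof -
        have "{1..n} = insert k (insert (Suc k) ({1..n} - {k, Suc k}))" using k by auto
        thus ?thesis by (metis (no_types, lifting) DiffD2 finite_Diff finite_atLeastAtMost finite_insert insertCI
          insertE n_not_Suc_n prod.insert mult.assoc)
      qed
      have "f z h = (\<Prod>i=1..n. (block_weight \<tau> \<eta> x z lam h i k * block_weight \<tau> \<eta> x z lam h i (Suc k)) *
          (\<Prod>j\<in>{1..n} - {k, Suc k}. block_weight \<tau> \<eta> x z lam h i j))"
        unfolding f_def by (intro prod.cong refl split)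
      also have "\<dots> = (\<Prod>i=1..n. block_weight \<tau> \<eta> x z lam h i k * block_weight \<tau> \<eta> x z lam h i (Suc k)) *
          (\<Prod>i=1..n. \<Prod>j\<in>{1..n} - {k, Suc k}. block_weight \<tau> \<eta> x z lam h i j)"
        by (rule prod.distrib)
      also have "(\<Prod>i=1..n. \<Prod>j\<in>{1..n} - {k, Suc k}. block_weight \<tau> \<eta> x z lam h i j) = C"
        unfolding C_def
      proof (intro prod.cong refl)
        fix i j assume "j \<in> {1..n} - {k, Suc k}"
        hence "j \<noteq> k" "j - 1 \<noteq> k" "j \<noteq> Suc k" by auto
        thus "block_weight \<tau> \<eta> x z lam h i j = block_weight \<tau> \<eta> x y lam g i j"
          by (simp add: block_weight_def hg z)
      qed
      also have "(\<Prod>i=1..n. block_weight \<tau> \<eta> x z lam h i k * block_weight \<tau> \<eta> x z lam h i (Suc k)) =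
          (\<Prod>i<n. \<omega> (z k) (z (Suc k)) i (h i k) (h (Suc i) k))"
        using k hg by (simp add: prod.atLeast1_atMost_eq block_weight_eq_w \<omega>_def \<alpha>_def \<gamma>_def)
      finally show ?thesis by (simp add: mult.commute)
    qed
    have chain: "(\<Sum>h\<in>{h \<in> states n. \<pi> h = \<pi> g}. f z h) =
        C * chain_sum N (\<alpha> 0 + 1) (\<omega> (z k) (z (Suc k))) n (\<gamma> n + 1)"
      if z: "\<And>j. j \<noteq> k \<Longrightarrow> j \<noteq> Suc k \<Longrightarrow> z j = y j" for z
    proof -
      let ?W = "\<lambda>p. C * (\<Prod>i<n. \<omega> (z k) (z (Suc k)) i (p i) (p (Suc i)))"
      define P where "P = chains N (\<alpha> 0 + 1) n (\<gamma> n + 1)"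
      define Q where "Q = {p \<in> P. \<forall>i<n. \<bar>p (Suc i) - p i\<bar> = 1}"
      have "(\<Sum>h\<in>{h \<in> states n. \<pi> h = \<pi> g}. f z h) = (\<Sum>p\<in>Q. ?W p)"
      proof (rule sum.reindex_bij_witness[of _ "\<lambda>p i j. if j = k then p i else g i j" "\<lambda>h i. h i k"])
        fix h assume h: "h \<in> {h \<in> states n. \<pi> h = \<pi> g}"
        hence "\<pi> h = \<pi> g" by simp
        hence "\<pi> h i j = \<pi> g i j" for i j by simp
        hence hg: "h i j = g i j" if "j \<noteq> k" for i j
          using that unfolding \<pi>_def by metis
        show "(\<lambda>i j. if j = k then h i k else g i j) = h"
          by (auto simp: fun_eq_iff hg)
        have hs: "h \<in> states n" using h by simp
        have "h i k \<in> N i" if "i \<le> n" for i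
          using states_horizontal[OF hs that, of k] states_horizontal[OF hs that, of "Suc k"] k
            hg[of "k - 1" i] hg[of "Suc k" i]
          by (auto simp: N_def nbrs_def \<alpha>_def \<gamma>_def)
        moreover have "h i k = 0" if "i > n" for i
          using hs that unfolding states_def by blast
        moreover have "h 0 k = \<alpha> 0 + 1" "h n k = \<gamma> n + 1"
          using states_boundary(1,3)[OF hs, of k] k by (simp_all add: bd)
        moreover have "\<bar>h (Suc i) k - h i k\<bar> = 1" if "i < n" for i
          using states_vertical[OF hs, of "Suc i" k] that k by simp
        ultimately show "(\<lambda>i. h i k) \<in> Q"
          unfolding Q_def P_def chains_def by auto
        show "?W (\<lambda>i. h i k) = f z h"
          using weight[OF _ z, of h] h by simp
      next
        fix p assume p: "p \<in> Q"
        let ?h = "\<lambda>i j. if j = k then p i else g i j"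
        show "(\<lambda>i. ?h i k) = p" by simp
        have pN: "\<bar>p i - \<alpha> i\<bar> = 1" "\<bar>p i - \<gamma> i\<bar> = 1" if "i \<le> n" for i
          using p that by (auto simp: Q_def P_def chains_def N_def nbrs_def)
        have ps: "\<bar>p (Suc i) - p i\<bar> = 1" if "i < n" for i
          using p that by (auto simp: Q_def)
        have p0: "p 0 = int k" "p n = int n - int k" "\<And>i. i > n \<Longrightarrow> p i = 0"
          using p by (auto simp: Q_def P_def chains_def bd)
        have "?h \<in> states n"
          unfolding states_def
        proof (intro CollectI conjI allI impI)
          show "?h i j = 0" if "n < i \<or> n < j" for i j
            using p0(3) g that k unfolding states_def by auto
          show "\<bar>?h (i + 1) j - ?h i j\<bar> = 1" if "i < n" "j \<le> n" for i j
            using ps[OF that(1)] states_vertical[OF g, of "Suc i" j] that by auto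
          show "\<bar>?h i (j + 1) - ?h i j\<bar> = 1" if "i \<le> n" "j < n" for i j
            using pN[OF that(1)] states_horizontal[OF g, of i "Suc j"] that k
            by (auto simp: \<alpha>_def \<gamma>_def abs_minus_commute)
          show "?h 0 j = int j" "?h j 0 = int j" "?h n j = int n - int j" "?h j n = int n - int j" if "j \<le> n" for j
            using states_boundary[OF g that] k p0 by auto
        qed
        thus "?h \<in> {h \<in> states n. \<pi> h = \<pi> g}"
          by (simp add: \<pi>_def fun_eq_iff)
      qed
      \<comment> \<open>Members of \<open>P\<close> outside \<open>Q\<close> come from no state:
        they have a vertical step other than 1 or -1, and a weight along that step vanishes.\<close>
      also have "\<dots> = (\<Sum>p\<in>P. ?W p)"
      proof (rule sum.mono_neutral_left)
        show "finite P" unfolding P_def by (rule finite_chains) (simp add: N_def finite_nbrs)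
        show "\<forall>p\<in>P - Q. ?W p = 0"
        proof
          fix p assume "p \<in> P - Q"
          then obtain i where i: "i < n" "\<bar>p (Suc i) - p i\<bar> \<noteq> 1" by (auto simp: Q_def)
          hence "\<omega> (z k) (z (Suc k)) i (p i) (p (Suc i)) = 0" by (simp add: \<omega>_def w_eq_0)
          with i(1) show "?W p = 0" by (auto simp: prod_zero_iff)
        qed
      qed (auto simp: Q_def)
      finally show ?thesis by (simp add: chain_sum_def P_def sum_distrib_left)
    qed
    have "chain_sum N (\<alpha> 0 + 1) (\<omega> (y k) (y (Suc k))) n (\<gamma> n + 1) =
      chain_sum N (\<alpha> 0 + 1) (\<omega> (y (Suc k)) (y k)) n (\<gamma> n + 1)"
      unfolding N_def \<omega>_def using bd \<alpha> \<gamma> by (intro column_pair_swap nz y) auto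
    thus ?thesis
      by (subst (1 2) chain) (auto simp: y'_def Transposition.transpose_def)
  qed
  have "Zpart \<tau> \<eta> n x z lam = (\<Sum>q\<in>\<pi> ` states n. \<Sum>h\<in>{h \<in> states n. \<pi> h = q}. f z h)" for z
  proof -
    have "Zpart \<tau> \<eta> n x z lam = sum (f z) (states n)" by (simp add: Zpart_def f_def)
    also have "\<dots> = (\<Sum>q\<in>\<pi> ` states n. \<Sum>h\<in>{h \<in> states n. \<pi> h = q}. f z h)"
      by (rule sum.image_gen[OF finite_states])
    finally show ?thesis .
  qed
  moreover have "(\<Sum>q\<in>\<pi> ` states n. \<Sum>h\<in>{h \<in> states n. \<pi> h = q}. f y' h) =
    (\<Sum>q\<in>\<pi> ` states n. \<Sum>h\<in>{h \<in> states n. \<pi> h = q}. f y h)"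
  proof (rule sum.cong[OF refl])
    fix q assume "q \<in> \<pi> ` states n"
    then obtain g where "g \<in> states n" "q = \<pi> g" by blast
    with fibre show "(\<Sum>h\<in>{h \<in> states n. \<pi> h = q}. f y' h) = (\<Sum>h\<in>{h \<in> states n. \<pi> h = q}. f y h)"
      by simp
  qed
  ultimately show ?thesis unfolding y'_def by simp
qed

end

text \<open>\<open>Q\<close> collects the permutations whose composition on the right preserves P.
  It is closed under composition and contains the adjacent transpositions; conjugating (a c) by (c
  c+1) gives (a c+1), so it contains all transpositions.\<close>

lemma permutes_adjacent_induct [consumes 1, case_names id step]:
  assumes "\<sigma> permutes {1..n::nat}"
    and id: "P id"
    and step: "\<And>p k. p permutes {1..n} \<Longrightarrow> P p \<Longrightarrow> 1 \<le> k \<Longrightarrow> k < n \<Longrightarrow> P (p \<circ> Transposition.transpose k (Suc k))"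
  shows "P \<sigma>"
proof -
  define Q where "Q = (\<lambda>s. s permutes {1..n} \<and> (\<forall>p. p permutes {1..n} \<longrightarrow> P p \<longrightarrow> P (p \<circ> s)))"
  have Q_id: "Q id" by (simp add: Q_def permutes_id)
  have Q_comp: "Q (s \<circ> s')" if "Q s" "Q s'" for s s'
    using that unfolding Q_def comp_assoc[symmetric] by (blast intro: permutes_compose)
  have Q_adj: "Q (Transposition.transpose k (Suc k))" if "1 \<le> k" "k < n" for k
    using that step by (auto simp: Q_def intro: permutes_swap_id)
  have Q_less: "Q (Transposition.transpose a c)" if "1 \<le> a" "a < c" "c \<le> n" for a c
    using that(2,3)
  proof (induction c)
    case (Suc c)
    show ?case
    proof (cases "a = c")
      case True
      thus ?thesis using Q_adj[of c] Suc.prems \<open>1 \<le> a\<close> by simp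
    next
      case False
      with Suc have "Q (Transposition.transpose a c)" by simp
      moreover have "Q (Transposition.transpose c (Suc c))" using Suc.prems \<open>1 \<le> a\<close> by (intro Q_adj) auto
      moreover have "Transposition.transpose a (Suc c) = Transposition.transpose c (Suc c) \<circ> (Transposition.transpose a c \<circ> Transposition.transpose c (Suc c))"
        using transpose_comp_triple[of "Suc c" a c] Suc.prems False
        by (simp add: transpose_commute comp_assoc)
      ultimately show ?thesis by (metis Q_comp)
    qed
  qed simp
  have Q_transpose: "Q (Transposition.transpose a c)" if "a \<in> {1..n}" "c \<in> {1..n}" "a \<noteq> c" for a c
    using Q_less[of a c] Q_less[of c a] that by (cases "a < c") (auto simp: transpose_commute)
  have "Q \<sigma>"
    using assms(1) finite_atLeastAtMost
  proof (induction rule: permutes_induct)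
    case id
    show ?case by (rule Q_id)
  next
    case (swap a c p)
    thus ?case by (intro Q_comp Q_transpose)
  qed
  hence "P (id \<circ> \<sigma>)"
    using id permutes_id unfolding Q_def by blast
  thus ?thesis by simp
qed

context vsos
begin

text \<open>Intermediate permutations may bring any two parameters next to each other, so the
  bracket condition is imposed on all ordered pairs.\<close>

lemma Zpart_permute:
  assumes nz: "\<And>k::int. b (lam + of_int k) \<noteq> 0"
    and y: "\<And>i j. i \<in> {1..n} \<Longrightarrow> j \<in> {1..n} \<Longrightarrow> i \<noteq> j \<Longrightarrow> b (y j - y i + 1) \<noteq> 0"
    and "\<sigma> permutes {1..n}"
  shows "Zpart \<tau> \<eta> n x (y \<circ> \<sigma>) lam = Zpart \<tau> \<eta> n x y lam"
  using assms(3)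
proof (induction rule: permutes_adjacent_induct)
  case (step p k)
  have "p (Suc k) \<in> {1..n}" "p k \<in> {1..n}" "p k \<noteq> p (Suc k)"
    using step.hyps permutes_in_image[OF step.hyps(1)] permutes_inj[OF step.hyps(1)] by (auto dest: injD)
  with y have "b ((y \<circ> p) (Suc k) - (y \<circ> p) k + 1) \<noteq> 0" by simp
  from Zpart_swap_adjacent[of lam, OF nz step.hyps(2,3) this] step.IH show ?case
    by (metis comp_assoc)
qed simp

end

section \<open>Freezing\<close>

lemma prod_atLeast1_Suc:
  fixes F :: "nat \<Rightarrow> 'a::comm_monoid_mult"
  shows "prod F {1..Suc m} = F 1 * (\<Prod>j=1..m. F (Suc j))"
  by (simp only: prod.atLeast1_atMost_eq One_nat_def prod.lessThan_Suc_shift)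

context vsos
begin

lemma w_plus: "w lam k (k + 1) (k + 1) (k + 2) u = b (u + 1) / b 1"
  by (simp add: w_def Rweight_def)

lemma w_minus: "w lam k (k - 1) (k - 1) (k - 2) u = b (u + 1) / b 1"
  by (simp add: w_def Rweight_def)

text \<open>At \<open>x (Suc m) = y 1\<close> the lower left block has weight 0 unless the height
  above its right lower corner is m + 1. That value forces the heights of column 1 and of row m.
  Deleting column 0 and the last row and subtracting 1 from the heights leaves a state of size m;
  the subtraction is made up for by lam + 1.\<close>

lemma Zpart_freeze:
  assumes nz: "\<And>k::int. b (lam + of_int k) \<noteq> 0" and x: "x (Suc m) = y 1"
  shows "Zpart \<tau> \<eta> (Suc m) x y lam =
    (\<Prod>i=1..m. b (x i - y 1 + 1) / b 1) * (\<Prod>j=1..m. b (y 1 - y (Suc j) + 1) / b 1) *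
    Zpart \<tau> \<eta> m x (\<lambda>j. y (Suc j)) (lam + 1)"
proof -
  define n where "n = Suc m"
  define f where "f = (\<lambda>h. \<Prod>i=1..n. \<Prod>j=1..n. block_weight \<tau> \<eta> x y lam h i j)"
  define C where "C = (\<Prod>i=1..m. b (x i - y 1 + 1) / b 1) * (\<Prod>j=1..m. b (y 1 - y (Suc j) + 1) / b 1)"
  define S where "S = {h \<in> states n. h m 1 = int n}"
  define ext where "ext = (\<lambda>g i j. if i > n \<or> j > n then 0 else if j = 0 then int i else if i = n then int n - int j
    else g i (j - 1) + 1 :: int)"
  define res where "res = (\<lambda>h i j. if i > m \<or> j > m then 0 else h i (Suc j) - 1 :: int)"
  have "Zpart \<tau> \<eta> n x y lam = sum f (states n)"
    by (simp add: Zpart_def f_def)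
  also have "\<dots> = sum f S"
  proof (rule sum.mono_neutral_right[OF finite_states])
    show "\<forall>h\<in>states n - S. f h = 0"
    proof
      fix h assume h: "h \<in> states n - S"
      hence hs: "h \<in> states n" by simp
      have bd: "h m 0 = int m" "h n 0 = int n" "h n 1 = int m"
        using states_boundary[OF hs, of m] states_boundary[OF hs, of n] states_boundary[OF hs, of 1]
        by (auto simp: n_def)
      have "\<bar>h m 1 - h m 0\<bar> = 1"
        using states_horizontal[OF hs, of m 1] by (simp add: n_def)
      hence "h m 1 = int m - 1" using h bd by (auto simp: S_def n_def)
      \<comment> \<open>With \<open>h m 1 = int m - 1\<close> this block is of the type proportional
        to the bracket of its spectral parameter, here [0].\<close>
      hence "block_weight \<tau> \<eta> x y lam h n 1 = 0"
        using bd x by (simp add: block_weight_eq_w w_def Rweight_def n_def)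
      hence z0: "(\<Prod>j=1..n. block_weight \<tau> \<eta> x y lam h n j) = 0"
        by (intro prod_zero bexI[of _ 1]) (auto simp: n_def)
      show "f h = 0"
        unfolding f_def by (rule prod_zero, simp, rule bexI[of _ n], rule z0, simp add: n_def)
    qed
  qed (auto simp: S_def)
  also have "\<dots> = (\<Sum>g\<in>states m. C * (\<Prod>i=1..m. \<Prod>j=1..m. block_weight \<tau> \<eta> x (\<lambda>j. y (Suc j)) (lam + 1) g i j))"
  proof (rule sum.reindex_bij_witness[of _ ext res])
    fix h assume h: "h \<in> S"
    hence hs: "h \<in> states n" and hm: "h m 1 = int n" by (auto simp: S_def)
    have bd: "h 0 k = int k" "h k 0 = int k" "h n k = int n - int k" "h k n = int n - int k" if "k \<le> n" for k
      using states_boundary[OF hs that] .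
    \<comment> \<open>Column 1 rises from 1 to m + 1 in m steps of size 1, so every step goes up.
      Likewise row m falls at every step from column 1 on.\<close>
    have c1: "h i 1 = int i + 1" if "i \<le> m" for i
      using states_column_bound[OF hs, of 1 0 i] states_column_bound[OF hs, of 1 i m] bd(1)[of 1] hm that
      by (simp add: n_def)
    have rm: "h m j = int n + 1 - int j" if "1 \<le> j" "j \<le> n" for j
      using states_row_bound[OF hs, of m 1 j] states_row_bound[OF hs, of m j n] bd(4)[of m] hm that
      by (simp add: n_def)
    have out: "h i j = 0" if "i > n \<or> j > n" for i j
      using hs that unfolding states_def by blast
    show "ext (res h) = h"
      by (intro ext) (auto simp: ext_def res_def out[unfolded n_def] bd[unfolded n_def] n_def not_less_eq)
    show "res h \<in> states m"
      unfolding states_def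
    proof (intro CollectI conjI allI impI)
      show "res h i j = 0" if "m < i \<or> m < j" for i j
        using that by (auto simp: res_def)
      show "\<bar>res h (i + 1) j - res h i j\<bar> = 1" if "i < m" "j \<le> m" for i j
        using states_vertical[OF hs, of "Suc i" "Suc j"] that by (simp add: res_def n_def)
      show "\<bar>res h i (j + 1) - res h i j\<bar> = 1" if "i \<le> m" "j < m" for i j
        using states_horizontal[OF hs, of i "Suc (Suc j)"] that by (simp add: res_def n_def)
      show "res h 0 k = int k" "res h k 0 = int k" "res h m k = int m - int k" "res h k m = int m - int k"
        if "k \<le> m" for k
        using bd(1)[of "Suc k"] bd(4)[of k] c1[of k] rm[of "Suc k"] that by (auto simp: res_def n_def)
    qed
    have bulk: "block_weight \<tau> \<eta> x y lam h i (Suc j) = block_weight \<tau> \<eta> x (\<lambda>j. y (Suc j)) (lam + 1) (res h) i j"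
      if "i \<in> {1..m}" "j \<in> {1..m}" for i j
    proof -
      have "i = Suc (i - 1)" "j = Suc (j - 1)" using that by auto
      then obtain i' j' where ij: "i = Suc i'" "j = Suc j'" by blast
      show ?thesis
        using w_shift[of lam 1 "res h i' j'" "res h i' j" "res h i j'" "res h i j" "x i - y (Suc j)"] that
        by (simp add: block_weight_eq_w res_def ij)
    qed
    have col: "block_weight \<tau> \<eta> x y lam h i 1 = b (x i - y 1 + 1) / b 1" if "i \<in> {1..m}" for i
    proof -
      have "h (i - 1) 0 = int i - 1" "h (i - 1) 1 = int i - 1 + 1" "h i 0 = int i - 1 + 1" "h i 1 = int i - 1 + 2"
        using c1[of i] c1[of "i - 1"] bd(2)[of i] bd(2)[of "i - 1"] that by (auto simp: n_def)
      thus ?thesis by (simp only: block_weight_eq_w w_plus diff_self_eq_0)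
    qed
    have row: "block_weight \<tau> \<eta> x y lam h n (Suc j) = b (y 1 - y (Suc j) + 1) / b 1" if "j \<in> {1..m}" for j
    proof -
      define a where "a = int n + 1 - int j"
      have "h (n - 1) (Suc j - 1) = a" "h (n - 1) (Suc j) = a - 1" "h n (Suc j - 1) = a - 1" "h n (Suc j) = a - 2"
        using rm[of j] rm[of "Suc j"] bd(3)[of j] bd(3)[of "Suc j"] that by (auto simp: n_def a_def)
      thus ?thesis by (simp only: block_weight_eq_w w_minus) (simp add: n_def x)
    qed
    have corner: "block_weight \<tau> \<eta> x y lam h n 1 = 1"
      using hm bd(2)[of m] bd(2)[of n] bd(3)[of 1] x nz[of "int m"]
      by (simp add: block_weight_eq_w w_def Rweight_def n_def)
    have "f h = (\<Prod>i=1..n. block_weight \<tau> \<eta> x y lam h i 1 * (\<Prod>j=1..m. block_weight \<tau> \<eta> x y lam h i (Suc j)))"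
      unfolding f_def n_def by (intro prod.cong refl prod_atLeast1_Suc)
    also have "\<dots> = (\<Prod>i=1..m. block_weight \<tau> \<eta> x y lam h i 1 * (\<Prod>j=1..m. block_weight \<tau> \<eta> x y lam h i (Suc j))) *
        (block_weight \<tau> \<eta> x y lam h n 1 * (\<Prod>j=1..m. block_weight \<tau> \<eta> x y lam h n (Suc j)))"
      by (simp add: n_def)
    also have "\<dots> = (\<Prod>i=1..m. b (x i - y 1 + 1) / b 1 *
        (\<Prod>j=1..m. block_weight \<tau> \<eta> x (\<lambda>j. y (Suc j)) (lam + 1) (res h) i j)) *
        (1 * (\<Prod>j=1..m. b (y 1 - y (Suc j) + 1) / b 1))"
      by (intro arg_cong2[where f = "(*)"] prod.cong refl bulk col row corner)
    finally show "C * (\<Prod>i=1..m. \<Prod>j=1..m. block_weight \<tau> \<eta> x (\<lambda>j. y (Suc j)) (lam + 1) (res h) i j) = f h"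
      by (simp only: prod.distrib C_def mult_ac mult_1)
  next
    fix g assume g: "g \<in> states m"
    have bd: "g 0 k = int k" "g k 0 = int k" "g m k = int m - int k" "g k m = int m - int k" if "k \<le> m" for k
      using states_boundary[OF g that] .
    have out: "g i j = 0" if "i > m \<or> j > m" for i j
      using g that unfolding states_def by blast
    show "res (ext g) = g"
      by (intro ext) (auto simp: ext_def res_def out n_def)
    have "ext g \<in> states n"
      unfolding states_def
    proof (intro CollectI conjI allI impI)
      show "ext g i j = 0" if "n < i \<or> n < j" for i j
        using that by (auto simp: ext_def)
      show "\<bar>ext g (i + 1) j - ext g i j\<bar> = 1" if "i < n" "j \<le> n" for i j
        using states_vertical[OF g, of "Suc i" "j - 1"] bd(3)[of "j - 1"] that
        by (cases j) (auto simp: ext_def n_def)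
      show "\<bar>ext g i (j + 1) - ext g i j\<bar> = 1" if "i \<le> n" "j < n" for i j
        using states_horizontal[OF g, of i j] bd(2)[of i] that
        by (cases j) (auto simp: ext_def n_def)
      show "ext g 0 k = int k" "ext g k 0 = int k" "ext g n k = int n - int k" "ext g k n = int n - int k"
        if "k \<le> n" for k
        using bd(1)[of "k - 1"] bd(4)[of k] that by (auto simp: ext_def n_def)
    qed
    moreover have "ext g m 1 = int n"
      using bd(2)[of m] by (simp add: ext_def n_def)
    ultimately show "ext g \<in> S" by (simp add: S_def)
  qed
  finally show ?thesis
    by (simp add: Zpart_def C_def n_def sum_distrib_left)
qed

end

section \<open>The sum over permutations\<close>

lemma Zpart_cong:
  assumes "\<And>i. i \<in> {1..n} \<Longrightarrow> x i = x' i" "\<And>j. j \<in> {1..n} \<Longrightarrow> y j = y' j"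
  shows "Zpart \<tau> \<eta> n x y lam = Zpart \<tau> \<eta> n x' y' lam"
  unfolding Zpart_def block_weight_def Let_def using assms by (intro sum.cong prod.cong refl) simp

text \<open>The transposition of \<open>Suc m\<close> and k enumerates the indices other than k by
  1, ..., m. The same transpositions arise when the permutations are split by the image of
  \<open>Suc m\<close>, so the nodes remaining after interpolation match the smaller permutation
  sum.\<close>

lemma prod_remove_transpose:
  assumes "k \<in> {1..Suc m}"
  shows "prod G ({1..Suc m} - {k}) = (\<Prod>j=1..m. G (Transposition.transpose (Suc m) k j))"
  by (rule prod.reindex_bij_witness[of _ "Transposition.transpose (Suc m) k" "Transposition.transpose (Suc m) k"])
    (use assms in \<open>auto simp: Transposition.transpose_def\<close>)

context vsos
begin

definition sum_term :: "nat \<Rightarrow> (nat \<Rightarrow> complex) \<Rightarrow> (nat \<Rightarrow> complex) \<Rightarrow> complex \<Rightarrow> complex" where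
  "sum_term n x z lam =
    (\<Prod>(i, j) \<in> {(i, j). 1 \<le> i \<and> i < j \<and> j \<le> n}.
      (b (z j - z i + 1) * b (z j - x i - 1)) / (b (z j - z i) * b (z j - x i))) *
    (\<Prod>j=1..n. b (z j - x j + lam + of_nat n - of_nat j) / b (z j - x j))"

definition perm_sum :: "nat \<Rightarrow> (nat \<Rightarrow> complex) \<Rightarrow> (nat \<Rightarrow> complex) \<Rightarrow> complex \<Rightarrow> complex" where
  "perm_sum n x y lam = (\<Sum>\<sigma> | \<sigma> permutes {1..n}. sum_term n x (y \<circ> \<sigma>) lam)"

text \<open>The factors with j = Suc m are split off. In the others lam + (m + 1) - j is read as
  (lam + 1) + m - j, the same shift of \<open>lam\<close> as in freezing.\<close>

lemma sum_term_Suc: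
  "sum_term (Suc m) x z lam = sum_term m x z (lam + 1) *
     (\<Prod>i=1..m. (b (z (Suc m) - z i + 1) * b (z (Suc m) - x i - 1)) / (b (z (Suc m) - z i) * b (z (Suc m) - x i))) *
     (b (z (Suc m) - x (Suc m) + lam) / b (z (Suc m) - x (Suc m)))"
proof -
  let ?g = "\<lambda>(i, j). (b (z j - z i + 1) * b (z j - x i - 1)) / (b (z j - z i) * b (z j - x i))"
  let ?P = "\<lambda>n. {(i, j). 1 \<le> i \<and> i < j \<and> j \<le> (n::nat)}"
  have fin: "finite (?P m)"
    by (rule finite_subset[of _ "{1..m} \<times> {1..m}"]) auto
  have "?P (Suc m) = ?P m \<union> (\<lambda>i. (i, Suc m)) ` {1..m}"
    by (auto simp: le_Suc_eq)
  hence "prod ?g (?P (Suc m)) = prod ?g (?P m) * prod ?g ((\<lambda>i. (i, Suc m)) ` {1..m})"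
    using fin by (simp only:) (rule prod.union_disjoint, auto)
  also have "prod ?g ((\<lambda>i. (i, Suc m)) ` {1..m}) =
    (\<Prod>i=1..m. (b (z (Suc m) - z i + 1) * b (z (Suc m) - x i - 1)) / (b (z (Suc m) - z i) * b (z (Suc m) - x i)))"
    by (subst prod.reindex) (auto simp: inj_on_def)
  finally have pairs: "prod ?g (?P (Suc m)) = prod ?g (?P m) *
    (\<Prod>i=1..m. (b (z (Suc m) - z i + 1) * b (z (Suc m) - x i - 1)) / (b (z (Suc m) - z i) * b (z (Suc m) - x i)))" .
  have split: "prod F {1..Suc m} = prod F {1..m} * F (Suc m)" for F :: "nat \<Rightarrow> complex"
    by simp
  have shift: "z j - x j + lam + of_nat (Suc m) - of_nat j = z j - x j + (lam + 1) + of_nat m - of_nat j" for j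
    by simp
  have last: "z (Suc m) - x (Suc m) + (lam + 1) + of_nat m - of_nat (Suc m) = z (Suc m) - x (Suc m) + lam"
    by simp
  show ?thesis
    unfolding sum_term_def pairs split shift last by (simp only: mult_ac)
qed

text \<open>A permutation of 1, ..., m + 1 is uniquely the transposition of m + 1 and k after a
  permutation q of 1, ..., m, where k is the image of m + 1.\<close>

lemma perm_sum_Suc:
  fixes x y :: "nat \<Rightarrow> complex" and m :: nat
  defines "z \<equiv> \<lambda>k. y \<circ> Transposition.transpose (Suc m) k"
  shows "perm_sum (Suc m) x y lam = (\<Sum>k=1..Suc m. perm_sum m x (z k) (lam + 1) *
     (\<Prod>i=1..m. (b (y k - z k i + 1) * b (y k - x i - 1)) / (b (y k - z k i) * b (y k - x i))) *
     (b (y k - x (Suc m) + lam) / b (y k - x (Suc m))))"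
proof -
  have ins: "{1..Suc m} = insert (Suc m) {1..m}" by auto
  have "perm_sum (Suc m) x y lam = (\<Sum>k=1..Suc m. \<Sum>q | q permutes {1..m}. sum_term (Suc m) x (z k \<circ> q) lam)"
    unfolding perm_sum_def z_def comp_assoc unfolding ins by (rule sum_over_permutations_insert) auto
  also have "\<dots> = (\<Sum>k=1..Suc m. \<Sum>q | q permutes {1..m}. sum_term m x (z k \<circ> q) (lam + 1) *
     (\<Prod>i=1..m. (b (y k - z k i + 1) * b (y k - x i - 1)) / (b (y k - z k i) * b (y k - x i))) *
     (b (y k - x (Suc m) + lam) / b (y k - x (Suc m))))"
  proof (intro sum.cong refl)
    fix k q assume "q \<in> {q. q permutes {1..m}}"
    hence q: "q permutes {1..m}" by simp
    have "q (Suc m) = Suc m" by (rule permutes_not_in[OF q]) simp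
    hence zN: "(z k \<circ> q) (Suc m) = y k" by (simp add: z_def)
    \<comment> \<open>The split-off factor does not depend on q: the factors involving z form a
      symmetric product over all i, and those involving x are not permuted.\<close>
    have "(\<Prod>i=1..m. b (y k - (z k \<circ> q) i + 1) / b (y k - (z k \<circ> q) i)) =
       (\<Prod>i=1..m. b (y k - z k i + 1) / b (y k - z k i))"
      using prod.permute[OF q, of "\<lambda>i. b (y k - z k i + 1) / b (y k - z k i)"] by (simp add: o_def)
    hence "(\<Prod>i=1..m. (b (y k - (z k \<circ> q) i + 1) * b (y k - x i - 1)) / (b (y k - (z k \<circ> q) i) * b (y k - x i))) =
       (\<Prod>i=1..m. (b (y k - z k i + 1) * b (y k - x i - 1)) / (b (y k - z k i) * b (y k - x i)))"
      unfolding times_divide_times_eq[symmetric] prod.distrib by (simp only:)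
    thus "sum_term (Suc m) x (z k \<circ> q) lam = sum_term m x (z k \<circ> q) (lam + 1) *
     (\<Prod>i=1..m. (b (y k - z k i + 1) * b (y k - x i - 1)) / (b (y k - z k i) * b (y k - x i))) *
     (b (y k - x (Suc m) + lam) / b (y k - x (Suc m)))"
      unfolding sum_term_Suc zN by simp
  qed
  finally show ?thesis
    by (simp only: perm_sum_def sum_distrib_right)
qed

text \<open>By symmetry the columns may be put in the order \<open>y k\<close>, \<open>z 1\<close>,
  ..., \<open>z m\<close> before freezing.\<close>

lemma Zpart_freeze_at:
  fixes y :: "nat \<Rightarrow> complex" and m k :: nat
  assumes nz: "\<And>k::int. b (lam + of_int k) \<noteq> 0" and k: "k \<in> {1..Suc m}"
    and y: "\<And>i j. i \<in> {1..Suc m} \<Longrightarrow> j \<in> {1..Suc m} \<Longrightarrow> i \<noteq> j \<Longrightarrow> b (y j - y i + 1) \<noteq> 0"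
  defines "z \<equiv> y \<circ> Transposition.transpose (Suc m) k"
  shows "Zpart \<tau> \<eta> (Suc m) (x(Suc m := y k)) y lam =
    (\<Prod>i=1..m. b (x i - y k + 1) / b 1) * (\<Prod>j=1..m. b (y k - z j + 1) / b 1) *
    Zpart \<tau> \<eta> m x z (lam + 1)"
proof -
  \<comment> \<open>A cycle that brings the last parameter to the front; the transposition has put
    \<open>y k\<close> last.\<close>
  define \<rho> where "\<rho> = (\<lambda>j. if j = 1 then Suc m else if j \<in> {2..Suc m} then j - 1 else j)"
  have \<rho>: "\<rho> permutes {1..Suc m}"
  proof (rule bij_imp_permutes)
    show "bij_betw \<rho> {1..Suc m} {1..Suc m}"
      by (rule bij_betwI[of _ _ _ "\<lambda>j. if j = Suc m then 1 else Suc j"]) (auto simp: \<rho>_def)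
    show "\<rho> j = j" if "j \<notin> {1..Suc m}" for j using that by (auto simp: \<rho>_def)
  qed
  have "Transposition.transpose (Suc m) k permutes {1..Suc m}"
    by (rule permutes_swap_id) (use k in auto)
  hence perm: "Transposition.transpose (Suc m) k \<circ> \<rho> permutes {1..Suc m}"
    using \<rho> by (intro permutes_compose)
  define z' where "z' = y \<circ> (Transposition.transpose (Suc m) k \<circ> \<rho>)"
  have z'1: "z' 1 = y k" by (simp add: z'_def \<rho>_def)
  have z'S: "z' (Suc j) = z j" if "j \<in> {1..m}" for j
    using that by (auto simp: z'_def z_def \<rho>_def)
  have "Zpart \<tau> \<eta> (Suc m) (x(Suc m := y k)) y lam = Zpart \<tau> \<eta> (Suc m) (x(Suc m := y k)) z' lam"
    unfolding z'_def using nz y perm by (intro Zpart_permute[symmetric]) auto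
  also have "\<dots> = (\<Prod>i=1..m. b ((x(Suc m := y k)) i - z' 1 + 1) / b 1) * (\<Prod>j=1..m. b (z' 1 - z' (Suc j) + 1) / b 1) *
    Zpart \<tau> \<eta> m (x(Suc m := y k)) (\<lambda>j. z' (Suc j)) (lam + 1)"
    by (rule Zpart_freeze[OF nz]) (use z'1 in simp)
  also have "\<dots> = (\<Prod>i=1..m. b (x i - y k + 1) / b 1) * (\<Prod>j=1..m. b (y k - z j + 1) / b 1) *
    Zpart \<tau> \<eta> m x z (lam + 1)"
    unfolding z'1 by (intro arg_cong2[where f = "(*)"] prod.cong refl Zpart_cong) (auto simp: z'S)
  finally show ?thesis .
qed

lemma states_0: "states 0 = {\<lambda>i j. 0}"
proof -
  have "h = (\<lambda>i j. 0)" if h: "h \<in> states 0" for h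
  proof (intro ext)
    fix i j
    show "h i j = 0"
      using h states_boundary(1)[OF h, of 0] unfolding states_def by (cases "i = 0 \<and> j = 0") auto
  qed
  moreover have "(\<lambda>i j. 0) \<in> states 0" by (simp add: states_def)
  ultimately show ?thesis by blast
qed

text \<open>After freezing and the induction hypothesis, the k-th term of the interpolation formula
  for \<open>x N\<close> is a factor independent of k times the k-th term of
  \<open>perm_sum_Suc\<close>. The conditions hold again for \<open>z k\<close> and lam + 1, which
  is why \<open>lam\<close> avoids the zeros at all integer shifts.\<close>

lemma Zpart_eq_perm_sum_generic:
  assumes "\<And>k::int. b (lam + of_int k) \<noteq> 0"
    and "\<And>i j. i \<in> {1..n} \<Longrightarrow> j \<in> {1..n} \<Longrightarrow> i \<noteq> j \<Longrightarrow> b (y j - y i) \<noteq> 0"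
    and "\<And>i j. i \<in> {1..n} \<Longrightarrow> j \<in> {1..n} \<Longrightarrow> i \<noteq> j \<Longrightarrow> b (y j - y i + 1) \<noteq> 0"
    and "\<And>i j. i \<in> {1..n} \<Longrightarrow> j \<in> {1..n} \<Longrightarrow> b (y j - x i) \<noteq> 0"
  shows "Zpart \<tau> \<eta> n x y lam =
    (\<Prod>i=1..n. \<Prod>j=1..n. b (y j - x i)) /
    (b 1 ^ (n * (n - 1)) * (\<Prod>j=1..n. b (lam + of_nat j - 1))) * perm_sum n x y lam"
  using assms
proof (induction n arbitrary: y lam)
  case 0
  have "{(i, j). 1 \<le> i \<and> i < j \<and> j \<le> (0::nat)} = {}" by auto
  thus ?case by (simp only: Zpart_def states_0 perm_sum_def sum_term_def) simp
next
  case (Suc m)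
  note nz = Suc.prems(1) and yy = Suc.prems(2) and yy1 = Suc.prems(3) and yx = Suc.prems(4)
  define N where "N = Suc m"
  define z where "z = (\<lambda>k. y \<circ> Transposition.transpose N k)"
  define L where "L = (\<Prod>j=1..m. b (lam + of_nat j))"
  define D where "D = (\<lambda>n y. \<Prod>i=1..n. \<Prod>j=1..n. b (y j - x i))"
  have tr: "Transposition.transpose N k j \<in> {1..N}" if "k \<in> {1..N}" "j \<in> {1..N}" for k j
    using that by (auto simp: Transposition.transpose_def N_def)
  have tr_inj: "Transposition.transpose N k i = Transposition.transpose N k j \<longleftrightarrow> i = j" for k i j
    by (auto dest: transpose_eq_imp_eq)
  have b_lam: "b lam \<noteq> 0" using nz[of 0] by simp
  have L0: "L \<noteq> 0" unfolding L_def using nz[of "int _"] by (auto simp: prod_zero_iff)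
  have prodL: "(\<Prod>j=1..N. b (lam + of_nat j - 1)) = b lam * L"
    unfolding N_def L_def prod_atLeast1_Suc by (simp add: diff_add_eq[symmetric])
  have IH: "Zpart \<tau> \<eta> m x (z k) (lam + 1) =
      D m (z k) / (b 1 ^ (m * (m - 1)) * L) * perm_sum m x (z k) (lam + 1)" if k: "k \<in> {1..N}" for k
  proof -
    have "Zpart \<tau> \<eta> m x (z k) (lam + 1) = (\<Prod>i=1..m. \<Prod>j=1..m. b (z k j - x i)) /
      (b 1 ^ (m * (m - 1)) * (\<Prod>j=1..m. b (lam + 1 + of_nat j - 1))) * perm_sum m x (z k) (lam + 1)"
    proof (rule Suc.IH)
      show "b (lam + 1 + of_int i) \<noteq> 0" for i using nz[of "1 + i"] by (simp add: add.assoc)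
      show "b (z k j - z k i) \<noteq> 0" "b (z k j - z k i + 1) \<noteq> 0"
        if "i \<in> {1..m}" "j \<in> {1..m}" "i \<noteq> j" for i j
        using yy[of "Transposition.transpose N k i" "Transposition.transpose N k j"]
          yy1[of "Transposition.transpose N k i" "Transposition.transpose N k j"]
          tr[OF k, of i] tr[OF k, of j] tr_inj that by (auto simp: z_def N_def)
      show "b (z k j - x i) \<noteq> 0" if "i \<in> {1..m}" "j \<in> {1..m}" for i j
        using yx[of i "Transposition.transpose N k j"] tr[OF k, of j] that by (auto simp: z_def N_def)
    qed
    thus ?thesis by (simp add: D_def L_def)
  qed
  define c where "c = (\<lambda>k. b (y k - x N + lam))"
  define A where "A = (\<lambda>k. \<Prod>j=1..m. b (y k - z k j + 1))"
  define B where "B = (\<lambda>k. \<Prod>j=1..m. b (y k - z k j))"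
  define X where "X = (\<lambda>k. \<Prod>j=1..m. b (x N - z k j))"
  define X' where "X' = (\<lambda>k. \<Prod>j=1..m. b (z k j - x N))"
  define U where "U = (\<lambda>k. \<Prod>i=1..m. b (x i - y k + 1))"
  define U' where "U' = (\<lambda>k. \<Prod>i=1..m. b (y k - x i - 1))"
  define V where "V = (\<lambda>k. \<Prod>i=1..m. b (y k - x i))"
  \<comment> \<open>Interpolation and freezing produce \<open>X\<close> and \<open>U\<close>, the
    claimed formula has the opposite arguments \<open>X'\<close> and \<open>U'\<close>; each product
    has m factors, so the signs cancel.\<close>
  have XU: "X k * U k = X' k * U' k" for k
    unfolding X_def U_def X'_def U'_def prod.distrib[symmetric]
  proof (rule prod.cong[OF refl])
    fix j
    have "b (x N - z k j) = - b (z k j - x N)" "b (x j - y k + 1) = - b (y k - x j - 1)"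
      by (rule br_opposite; simp)+
    thus "b (x N - z k j) * b (x j - y k + 1) = b (z k j - x N) * b (y k - x j - 1)" by simp
  qed
  have DN: "D N y = D m (z k) * V k * X' k * b (y k - x N)" if k: "k \<in> {1..N}" for k
  proof -
    have pr: "(\<Prod>j=1..N. F (y j)) = (\<Prod>j=1..m. F (z k j)) * F (y k)" for F :: "complex \<Rightarrow> complex"
    proof -
      have "(\<Prod>j=1..N. F (y j)) = F (y k) * (\<Prod>j\<in>{1..N} - {k}. F (y j))"
        using k by (intro prod.remove) auto
      thus ?thesis
        using prod_remove_transpose[of k m "\<lambda>j. F (y j)"] k by (simp add: z_def N_def mult.commute)
    qed
    have "D N y = (\<Prod>i=1..N. (\<Prod>j=1..m. b (z k j - x i)) * b (y k - x i))"
      unfolding D_def by (intro prod.cong refl pr)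
    also have "\<dots> = D m (z k) * X' k * (V k * b (y k - x N))"
      by (simp add: prod.distrib D_def X'_def V_def N_def)
    finally show ?thesis by simp
  qed
  have nonz: "B k \<noteq> 0" "V k \<noteq> 0" "b (y k - x N) \<noteq> 0" if k: "k \<in> {1..N}" for k
  proof -
    have "Transposition.transpose N k j \<noteq> k" if "j \<in> {1..m}" for j
      using that by (auto simp: Transposition.transpose_def N_def)
    hence "b (y k - z k j) \<noteq> 0" if "j \<in> {1..m}" for j
      using yy[of "Transposition.transpose N k j" k] tr[OF k, of j] that k by (auto simp: z_def N_def)
    thus "B k \<noteq> 0" by (simp add: B_def)
    show "V k \<noteq> 0" "b (y k - x N) \<noteq> 0" using yx k by (auto simp: V_def N_def prod_zero_iff)
  qed
  have pow: "b 1 ^ (N * m) = b 1 ^ m * b 1 ^ m * b 1 ^ (m * (m - 1))"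
    by (cases m) (simp_all add: N_def algebra_simps flip: power_add)
  have "Zpart \<tau> \<eta> N x y lam * b lam = (\<Sum>k=1..N. b (lam - x N + y k) *
    (Zpart \<tau> \<eta> N (x(N := y k)) y lam / (\<Prod>j\<in>{1..N} - {k}. b (y k - y j))) *
    (\<Prod>j\<in>{1..N} - {k}. b (x N - y j)))"
    using yy by (intro Zpart_interpolation) (auto simp: N_def)
  also have "\<dots> = (\<Sum>k=1..N. D N y / (b 1 ^ (N * m) * L) *
     (perm_sum m x (z k) (lam + 1) * (A k * U' k / (B k * V k)) * (c k / b (y k - x N))))"
  proof (rule sum.cong[OF refl])
    fix k assume k: "k \<in> {1..N}"
    have c: "b (lam - x N + y k) = c k" unfolding c_def by (rule br_same) simp
    have B: "(\<Prod>j\<in>{1..N} - {k}. b (y k - y j)) = B k" and X: "(\<Prod>j\<in>{1..N} - {k}. b (x N - y j)) = X k"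
      using prod_remove_transpose[of k m] k by (simp_all add: B_def X_def z_def N_def)
    have Z: "Zpart \<tau> \<eta> N (x(N := y k)) y lam = (U k / b 1 ^ m) * (A k / b 1 ^ m) * Zpart \<tau> \<eta> m x (z k) (lam + 1)"
      using Zpart_freeze_at[OF nz, of k m y x] yy1 k
      by (simp add: N_def z_def U_def A_def prod_dividef)
    have "c k * ((U k / b 1 ^ m) * (A k / b 1 ^ m) * (D m (z k) / (b 1 ^ (m * (m - 1)) * L) * perm_sum m x (z k) (lam + 1)) / B k) * X k =
      (X k * U k) * (c k * A k * D m (z k) * perm_sum m x (z k) (lam + 1) / (b 1 ^ m * b 1 ^ m * b 1 ^ (m * (m - 1)) * L * B k))"
      by (simp add: mult_ac)
    also have "\<dots> = D m (z k) * V k * X' k * b (y k - x N) / (b 1 ^ m * b 1 ^ m * b 1 ^ (m * (m - 1)) * L) *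
     (perm_sum m x (z k) (lam + 1) * (A k * U' k / (B k * V k)) * (c k / b (y k - x N)))"
      unfolding XU using nonz[OF k] by (simp add: field_simps)
    finally show "b (lam - x N + y k) *
        (Zpart \<tau> \<eta> N (x(N := y k)) y lam / (\<Prod>j\<in>{1..N} - {k}. b (y k - y j))) *
        (\<Prod>j\<in>{1..N} - {k}. b (x N - y j)) = D N y / (b 1 ^ (N * m) * L) *
       (perm_sum m x (z k) (lam + 1) * (A k * U' k / (B k * V k)) * (c k / b (y k - x N)))"
      unfolding c B X Z IH[OF k] DN[OF k] pow .
  qed
  also have "\<dots> = D N y / (b 1 ^ (N * m) * L) * perm_sum N x y lam"
    unfolding sum_distrib_left[symmetric] N_def perm_sum_Suc
    by (simp add: A_def U'_def B_def V_def c_def z_def N_def prod_dividef prod.distrib)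
  finally have "Zpart \<tau> \<eta> N x y lam = D N y / (b 1 ^ (N * m) * (b lam * L)) * perm_sum N x y lam"
    using b_lam L0 by (simp add: field_simps)
  thus ?case
    unfolding prodL[symmetric] by (simp add: N_def D_def)
qed

text \<open>A block has \<open>b (lam + of_int a)\<close> in its denominator only if its upper left
  and lower right heights agree, and such heights lie between 0 and n - 1. Hence the partition
  function has no poles beyond those excluded by the assumption on \<open>lam\<close>.\<close>

lemma isCont_block_weight:
  assumes h: "h \<in> states n" and ij: "i \<in> {1..n}" "j \<in> {1..n}"
    and lam: "\<And>j. j \<in> {1..n} \<Longrightarrow> b (lam + of_nat j - 1) \<noteq> 0"
  shows "isCont (\<lambda>t. block_weight \<tau> \<eta> x (\<lambda>j. y j + of_nat j * t) (lam + t) h i j) 0"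
proof -
  have if_cont: "isCont (\<lambda>t. if P then f t else g t) z"
    if "isCont f z" "isCont g z" for P and f g :: "complex \<Rightarrow> complex" and z
    using that by (cases P) simp_all
  define a where "a = h (i - 1) (j - 1)"
  define k l m r where "k = h (i - 1) j - a" and "l = h i j - h (i - 1) j"
    and "m = h i j - h i (j - 1)" and "r = h i (j - 1) - a"
  have eq: "block_weight \<tau> \<eta> x (\<lambda>j. y j + of_nat j * t) (lam + t) h i j =
     Rweight \<tau> \<eta> k l m r (lam + t + of_int a) (x i - (y j + of_nat j * t))" for t
    by (simp add: block_weight_def Let_def a_def k_def l_def m_def r_def)
  show ?thesis
  proof (cases "k + l = 0")
    case True
    hence "h i j = a" by (simp add: k_def l_def)
    \<comment> \<open>Two bounds on the same height, from the upper left and the lower right corner,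
      add up to 2 a \<le> 2 n - 2.\<close>
    moreover have "0 \<le> a" "a \<le> int (i - 1) + int (j - 1)"
      using states_bounds[OF h, of "i - 1" "j - 1"] ij by (auto simp: a_def)
    moreover have "h i j \<le> 2 * int n - int i - int j"
      using states_bounds[OF h, of i j] ij by auto
    ultimately have "0 \<le> a" "a < int n" using ij by auto
    then obtain j' where j': "j' \<in> {1..n}" "a = int j' - 1"
      by (intro that[of "nat (a + 1)"]) auto
    hence "lam + of_int a = lam + of_nat j' - 1" by simp
    hence "b (lam + of_int a) \<noteq> 0" using lam[OF j'(1)] by metis
    thus ?thesis
      unfolding eq Rweight_def by (intro if_cont continuous_intros) auto
  next
    case False
    have Rw: "Rweight \<tau> \<eta> k l m r L u = (if (k, l, m, r) = (1, 1, 1, 1) \<or> (k, l, m, r) = (-1, -1, -1, -1)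
       then b (u + 1) / b 1 else 0)" for L u
      using False by (auto simp: Rweight_def)
    show ?thesis
      unfolding eq Rw by (intro if_cont continuous_intros b_1_nonzero)
  qed
qed

text \<open>The exceptional parameters are reached from generic ones along the line
  \<open>lam + t\<close>, \<open>y\<^sub>j + j t\<close>, on which only countably many points are not generic.\<close>

lemma Zpart_eq_perm_sum:
  assumes lam: "\<And>j. j \<in> {1..n} \<Longrightarrow> b (lam + of_nat j - 1) \<noteq> 0"
    and yy: "\<And>i j. i \<in> {1..n} \<Longrightarrow> j \<in> {1..n} \<Longrightarrow> i \<noteq> j \<Longrightarrow> b (y j - y i) \<noteq> 0"
    and yx: "\<And>i j. i \<in> {1..n} \<Longrightarrow> j \<in> {1..n} \<Longrightarrow> b (y j - x i) \<noteq> 0"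
  shows "Zpart \<tau> \<eta> n x y lam =
    (\<Prod>i=1..n. \<Prod>j=1..n. b (y j - x i)) /
    (b 1 ^ (n * (n - 1)) * (\<Prod>j=1..n. b (lam + of_nat j - 1))) * perm_sum n x y lam"
proof -
  \<comment> \<open>The parameters move at different speeds j \<ge> 1, so every bracket in
    \<open>lam\<close>, in y j - x i or in y j - y i with i \<noteq> j is that of a nonconstant
    function of t and has countably many zeros.\<close>
  define Y where "Y = (\<lambda>t j. y j + of_nat j * t)"
  define f where "f = (\<lambda>t. Zpart \<tau> \<eta> n x (Y t) (lam + t))"
  define g where "g = (\<lambda>t. (\<Prod>i=1..n. \<Prod>j=1..n. b (Y t j - x i)) /
    (b 1 ^ (n * (n - 1)) * (\<Prod>j=1..n. b (lam + t + of_nat j - 1))) * perm_sum n x (Y t) (lam + t))"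
  define B where "B = (\<Union>k::int. {t. b (lam + of_int k + 1 * t) = 0}) \<union>
     (\<Union>(i, j)\<in>{1..n} \<times> {1..n}. {t. b (y j - x i + of_nat j * t) = 0}) \<union>
     (\<Union>(i, j)\<in>{(i, j). i \<in> {1..n} \<and> j \<in> {1..n} \<and> i \<noteq> j}.
        {t. b (y j - y i + (of_nat j - of_nat i) * t) = 0} \<union> {t. b (y j - y i + 1 + (of_nat j - of_nat i) * t) = 0})"
  have contY: "isCont (\<lambda>t. Y t j) s" for j s
    unfolding Y_def by (intro continuous_intros)
  have Y0: "Y 0 = y" by (simp add: Y_def)
  have "f 0 = g 0"
  proof (rule isCont_eq_off_countable[where f = f and g = g])
    show "isCont f 0"
      unfolding f_def Zpart_def Y_def using lam by (intro continuous_intros isCont_block_weight) auto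
    show "isCont g 0"
      unfolding g_def perm_sum_def sum_term_def case_prod_unfold o_def
    proof (intro continuous_intros contY; (unfold Y0)?)
      show "b 1 ^ (n * (n - 1)) * (\<Prod>j=1..n. b (lam + 0 + of_nat j - 1)) \<noteq> 0"
        using lam by (auto simp: prod_zero_iff)
      fix \<sigma> assume "\<sigma> \<in> {\<sigma>. \<sigma> permutes {1..n}}"
      hence p: "\<sigma> permutes {1..n}" by simp
      have \<sigma>: "\<sigma> i \<in> {1..n} \<longleftrightarrow> i \<in> {1..n}" "\<sigma> i = \<sigma> j \<longleftrightarrow> i = j" for i j
        by (simp_all only: permutes_in_image[OF p] inj_eq[OF permutes_inj[OF p]])
      show "b (y (\<sigma> j) - x j) \<noteq> 0" if "j \<in> {1..n}" for j
        using yx[of j "\<sigma> j"] \<sigma> that by simp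
      show "b (y (\<sigma> (snd p)) - y (\<sigma> (fst p))) * b (y (\<sigma> (snd p)) - x (fst p)) \<noteq> 0"
        if "p \<in> {p. 1 \<le> fst p \<and> fst p < snd p \<and> snd p \<le> n}" for p
        using yx[of "fst p" "\<sigma> (snd p)"] yy[of "\<sigma> (fst p)" "\<sigma> (snd p)"] \<sigma> that by auto
    qed
    show "countable B"
      unfolding B_def
      by (intro countable_Un countable_UN countableI_type countable_b_zeros)
        (auto intro!: countable_b_zeros countable_Un)
    show "f t = g t" if t: "t \<notin> B" for t
      unfolding f_def g_def
    proof (rule Zpart_eq_perm_sum_generic)
      fix k :: int
      have "t \<notin> {t. b (lam + of_int k + 1 * t) = 0}"
        using t unfolding B_def by blast
      moreover have "lam + t + of_int k = lam + of_int k + 1 * t" by simp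
      ultimately show "b (lam + t + of_int k) \<noteq> 0" by (simp only: mem_Collect_eq not_False_eq_True)
    next
      fix i j assume ij: "i \<in> {1..n}" "j \<in> {1..n}"
      hence "t \<notin> {t. b (y j - x i + of_nat j * t) = 0}"
        using t unfolding B_def by blast
      moreover have "Y t j - x i = y j - x i + of_nat j * t" by (simp add: Y_def)
      ultimately show "b (Y t j - x i) \<noteq> 0" by (simp only: mem_Collect_eq not_False_eq_True)
      assume "i \<noteq> j"
      with ij have "t \<notin> {t. b (y j - y i + (of_nat j - of_nat i) * t) = 0}"
        "t \<notin> {t. b (y j - y i + 1 + (of_nat j - of_nat i) * t) = 0}"
        using t unfolding B_def by blast+
      moreover have "Y t j - Y t i = y j - y i + (of_nat j - of_nat i) * t"
        "Y t j - Y t i + 1 = y j - y i + 1 + (of_nat j - of_nat i) * t"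
        by (simp_all add: Y_def algebra_simps)
      ultimately show "b (Y t j - Y t i) \<noteq> 0" "b (Y t j - Y t i + 1) \<noteq> 0"
        by (simp_all only: mem_Collect_eq not_False_eq_True)
    qed
  qed
  thus ?thesis by (simp add: f_def g_def Y0)
qed

end

text \<open>Genericity takes the form that the brackets in the denominators of the formula do not
  vanish; for [1] this follows from the condition on \<eta>.\<close>

theorem theorem4p1:
  fixes \<tau> \<eta> lam :: complex and n :: nat and x y :: "nat \<Rightarrow> complex"
  assumes "Im \<tau> > 0"
    and "\<eta> \<notin> {of_int k + \<tau> * of_int l | k l. True}"
    and "\<And>j. j \<in> {1..n} \<Longrightarrow> br \<tau> \<eta> (lam + of_nat j - 1) \<noteq> 0"
    and "\<And>i j. i \<in> {1..n} \<Longrightarrow> j \<in> {1..n} \<Longrightarrow> i \<noteq> j \<Longrightarrow> br \<tau> \<eta> (y j - y i) \<noteq> 0"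
    and "\<And>i j. i \<in> {1..n} \<Longrightarrow> j \<in> {1..n} \<Longrightarrow> br \<tau> \<eta> (y j - x i) \<noteq> 0"
  shows "Zpart \<tau> \<eta> n x y lam =
    (\<Prod>i=1..n. \<Prod>j=1..n. br \<tau> \<eta> (y j - x i)) /
    (br \<tau> \<eta> 1 ^ (n * (n - 1)) * (\<Prod>j=1..n. br \<tau> \<eta> (lam + of_nat j - 1))) *
    (\<Sum>\<sigma> | \<sigma> permutes {1..n}.
      (\<Prod>(i, j) \<in> {(i, j). 1 \<le> i \<and> i < j \<and> j \<le> n}.
        (br \<tau> \<eta> (y (\<sigma> j) - y (\<sigma> i) + 1) * br \<tau> \<eta> (y (\<sigma> j) - x i - 1)) /
        (br \<tau> \<eta> (y (\<sigma> j) - y (\<sigma> i)) * br \<tau> \<eta> (y (\<sigma> j) - x i))) *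
      (\<Prod>j=1..n.
        br \<tau> \<eta> (y (\<sigma> j) - x j + lam + of_nat n - of_nat j) /
        br \<tau> \<eta> (y (\<sigma> j) - x j)))"
proof -
  interpret vsos \<tau> \<eta> using assms(1,2) by unfold_locales
  show ?thesis
    using Zpart_eq_perm_sum[of n lam y x] assms(3-5) unfolding perm_sum_def sum_term_def o_apply by blast
qed

end
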